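(* Let $\mathcal{I}$ be a fractional ideal of the local ring $\mathcal{O}$ of an algebroid curve, and let $G$ be a fixed Standard Basis for $\mathcal{O}$. For each $i\in I$ let $B_i$ be a finite subset of $\mathcal{T}^i=\{f\in\mathcal{I}: v_j(f)=\infty \text{ for all } j\in I\setminus\{i\}\}$ whose image in $\mathcal{I}_i$ is a Standard Basis for $\mathcal{I}^i$. Let $H_0\subset\mathcal{I}\setminus\{0\}$ be a finite set of generators for $\mathcal{I}$ with $\bigcup_{i\in I}B_i\subseteq H_0$. Consider the following procedure with input $G,H_0$. For $j=0,1,2,\ldots$, given $H_j$: 1. let $\rho=(\rho_1,\ldots,\rho_r)\in\mathbb{Z}^r$ be an upper bound for $\kappa=(\kappa_1,\ldots,\kappa_r)$ (i.e. $\rho_i\ge\kappa_i$ for all $i$); 2. let $\mathcal{S}$ be the set (up to multiplication by elements of $\mathbb{K}\setminus\{0\}$) of all $f$ such that, for some $k\in I$, $f$ is an $S_k$-process of $H_j$ over $G$ and $v_i(f)<\rho_i$ for some $i\in I$; 3. for each $f\in\mathcal{S}$ compute a final reduction of $f$ modulo $(H_j,G)$, and let $\mathcal{R}$ be the set of the nonzero final reductions so obtained; 4. put $H_{j+1}=H_j\cup\mathcal{R}$; if $H_{j+1}=H_j$, stop and output $H=H_{j+1}$. Then the procedure always stops after finitely many iterations, and its output $H$ is a Standard Basis for $\mathcal{I}$.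
   Context: Setting. $\mathbb{K}$ is an algebraically closed field. $(\mathcal{O},\mathcal{M},\mathbb{K})$ is a one-dimensional complete Noetherian local ring with coefficient field $\mathbb{K}$, $\mathcal{O}=\mathbb{K}[[X_1,\ldots,X_n]]/Q$ with $Q$ a proper radical ideal and $n=\dim_{\mathbb{K}}\mathcal{M}/\mathcal{M}^2$; one calls $Q$ an algebroid curve and $\mathcal{O}$ its local ring. Write $Q=\bigcap_{i\in I}P_i$, $I=\{1,\ldots,r\}$, with $P_i$ the distinct minimal primes over $Q$ (branches), each with $\mathcal{O}_i=\mathbb{K}[[X_1,\ldots,X_n]]/P_i$ of dimension one. The integral closure of $\mathcal{O}_i$ in its fraction field $\mathcal{Q}_i$ is a discrete valuation ring $\overline{\mathcal{O}_i}=\mathbb{K}[[t_i]]$. The total ring of fractions of $\mathcal{O}$ is $\mathcal{Q}=\bigoplus_{i\in I}\mathcal{Q}_i=\bigoplus_{i\in I}\mathbb{K}((t_i))$, and $\mathcal{O}\hookrightarrow\mathcal{Q}$ by $g\mapsto(g_1,\ldots,g_r)$, $g_i$ the image of $g$ in $\mathcal{O}_i$. For $h=(h_1,\ldots,h_r)\in\mathcal{Q}$ put $v_i(h)=\operatorname{ord}_{t_i}(h_i)\in\mathbb{Z}\cup\{\infty\}$ ($v_i(h)=\infty$ if $h_i=0$) and $v(h)=(v_1(h),\ldots,v_r(h))$. A fractional ideal of $\mathcal{O}$ means a finitely generated $\mathcal{O}$-submodule of $\mathcal{Q}$ containing a non zero divisor of $\mathcal{Q}$. Limits in $\mathcal{Q}$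 are taken in the product of the $t_i$-adic topologies. Reductions. Let $G\subset\mathcal{M}\setminus\{0\}$ be finite and $H\subset\mathcal{Q}\setminus\{0\}$. A $G$-product is an element $G^{\alpha}=\prod_{g_i\in G}g_i^{\alpha_i}$ with $\alpha_i\in\mathbb{N}=\{0,1,2,\ldots\}$. For nonzero $f\in\mathcal{Q}$ and $k\in I_f:=\{i\in I: v_i(f)\neq\infty\}$, an element $f'$ is a $k$-reduction of $f$ modulo $(H,G)$ if there are $c\in\mathbb{K}$, $h\in H$ and a $G$-product $G^\alpha$ with $f'=f-cG^\alpha h$, $v_i(f')\ge v_i(f)$ for all $i\in I$ and $v_k(f')>v_k(f)$. A reduction of $f$ modulo $(H,G)$ is a $k$-reduction for some $k\in I_f$. An element $f'$ is a final reduction of a nonzero $f\in\mathcal{Q}$ modulo $(H,G)$ if $f'$ is obtained from $f$ by a (possibly infinite) sequence of reductions modulo $(H,G)$, $f_0=f$, $f_j$ a reduction of $f_{j-1}$ (in the infinite case $f'$ is the limit of the $f_j$), and $f'$ admits no reduction modulo $(H,G)$ (the element $0$ admits none). Infinite sequences of reductions are regarded as a single computation. A Standard Basis for $\mathcal{O}$ is a finite set $G\subset\mathcal{M}\setminus\{0\}$ such that every nonzero element of $\mathcal{O}$ admits a reduction modulo $(\{1\},G)$. With $G$ fixed, a Standard Basis for a fractional ideal $\mathcal{I}$ is a finite set $H\subset\mathcal{I}\setminus\{0\}$ such that every nonzero element of $\mathcal{I}$ admits a reduction modulo $(H,G)$. The sets $\mathcal{I}^i$. $\mathcal{I}_i$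 is the image of $\mathcal{I}$ under the projection $\mathcal{Q}\to\mathcal{Q}_i$, and $\mathcal{I}^i\subseteq\mathcal{I}_i$ is the image of $\mathcal{T}^i$; it is a fractional ideal of $\mathcal{O}_i$. That the image of $B_i\subset\mathcal{T}^i\setminus\{0\}$ is a Standard Basis for $\mathcal{I}^i$ means (with respect to the image of $G$ in $\mathcal{O}_i$): for every nonzero $f\in\mathcal{T}^i$ there are $h\in B_i$ and a $G$-product $G^\alpha$ with $v_i(f)=v_i(G^\alpha h)$. The integer $\kappa_i$ is the conductor of $v_i(\mathcal{I}^i)$, i.e. the integer with $\kappa_i+(\mathbb{N}\cup\{\infty\})\subseteq v_i(\mathcal{I}^i)$ and $\kappa_i-1\notin v_i(\mathcal{I}^i)$. $S_k$-processes. For $k\in I$, an $S_k$-process of $H$ over $G$ is an element $c_1G^{\alpha_1}h_1+c_2G^{\alpha_2}h_2$ with $c_1,c_2\in\mathbb{K}$, $h_1,h_2\in H$ and $G$-products $G^{\alpha_1},G^{\alpha_2}$ such that $v_k(c_1G^{\alpha_1}h_1+c_2G^{\alpha_2}h_2)>\min\{v_k(G^{\alpha_1}h_1),v_k(G^{\alpha_2}h_2)\}$. *)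

theory Defs
  imports
    "HOL-Computational_Algebra.Formal_Laurent_Series"
    "HOL-Library.Cardinality"
    "HOL-Library.Function_Algebras"
    "HOL-Library.Extended"
    "HOL-Library.Extended_Nat"
begin

section \<open>Formal power series in finitely many variables\<close>

text \<open>
  The variables are the elements of the finite type \<open>'n\<close>, a monomial is its exponent function
  \<open>'n \<Rightarrow> nat\<close>; so the type below is the ring of power series in \<open>CARD('n)\<close> variables over \<open>'k\<close>.
\<close>

typedef ('k, 'n) mps = "{f :: ('n \<Rightarrow> nat) \<Rightarrow> 'k. True}"
  morphisms mps_nth Abs_mps
  by simp

lemma mps_nth_Abs [simp]: "mps_nth (Abs_mps f) = f"
  by (simp add: Abs_mps_inverse)

lemma mps_ext: "(\<And>e. mps_nth p e = mps_nth q e) \<Longrightarrow> p = q"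
  by (metis ext mps_nth_inject)

definition exp_splits :: "('n \<Rightarrow> nat) \<Rightarrow> (('n \<Rightarrow> nat) \<times> ('n \<Rightarrow> nat)) set" where
  "exp_splits e = {(u, v). u + v = e}"

lemma finite_exp_splits [simp]: "finite (exp_splits (e :: 'n::finite \<Rightarrow> nat))"
proof -
  let ?D = "PiE UNIV (\<lambda>i. {..e i})"
  have "finite ?D" by (intro finite_PiE) auto
  moreover have "exp_splits e \<subseteq> ?D \<times> ?D"
    by (auto simp: exp_splits_def PiE_def)
  ultimately show ?thesis
    by (meson finite_SigmaI finite_subset)
qed

instantiation mps :: (comm_ring_1, finite) comm_ring_1
begin

definition "0 = Abs_mps (\<lambda>_. 0)"
definition "1 = Abs_mps (\<lambda>e. if e = 0 then 1 else 0)"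
definition "p + q = Abs_mps (\<lambda>e. mps_nth p e + mps_nth q e)"
definition "p - q = Abs_mps (\<lambda>e. mps_nth p e - mps_nth q e)"
definition "- p = Abs_mps (\<lambda>e. - mps_nth p e)"
definition "p * q = Abs_mps (\<lambda>e. \<Sum>(u, v)\<in>exp_splits e. mps_nth p u * mps_nth q v)"

instance
proof
  fix a b c :: "('a, 'b) mps"
  show "a * b * c = a * (b * c)"
  proof (rule mps_ext)
    fix e :: "'b \<Rightarrow> nat"
    let ?A = "mps_nth a" and ?B = "mps_nth b" and ?C = "mps_nth c"
    have "mps_nth (a * b * c) e =
        (\<Sum>x\<in>exp_splits e. \<Sum>y\<in>exp_splits (fst x). ?A (fst y) * ?B (snd y) * ?C (snd x))"
      by (simp add: times_mps_def split_def sum_distrib_right)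
    also have "\<dots> = (\<Sum>(x, y)\<in>(SIGMA x:exp_splits e. exp_splits (fst x)).
        ?A (fst y) * ?B (snd y) * ?C (snd x))"
      by (rule sum.Sigma) auto
    also have "\<dots> = (\<Sum>(x, y)\<in>(SIGMA x:exp_splits e. exp_splits (snd x)).
        ?A (fst x) * (?B (fst y) * ?C (snd y)))"
      by (rule sum.reindex_bij_witness
            [where j = "\<lambda>(x, y). ((fst y, snd y + snd x), (snd y, snd x))"
               and i = "\<lambda>(x, y). ((fst x + fst y, snd y), (fst x, fst y))"])
         (auto simp: exp_splits_def add.assoc mult.assoc)
    also have "\<dots> = (\<Sum>x\<in>exp_splits e. \<Sum>y\<in>exp_splits (snd x).
        ?A (fst x) * (?B (fst y) * ?C (snd y)))"
      by (rule sum.Sigma [symmetric]) auto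
    also have "\<dots> = mps_nth (a * (b * c)) e"
      by (simp add: times_mps_def split_def sum_distrib_left)
    finally show "mps_nth (a * b * c) e = mps_nth (a * (b * c)) e" .
  qed
  show "a * b = b * a"
  proof (rule mps_ext)
    fix e :: "'b \<Rightarrow> nat"
    have "(\<Sum>(u, v)\<in>exp_splits e. mps_nth a u * mps_nth b v) =
          (\<Sum>(u, v)\<in>exp_splits e. mps_nth b u * mps_nth a v)"
      by (rule sum.reindex_bij_witness[where i = prod.swap and j = prod.swap])
         (auto simp: exp_splits_def add.commute mult.commute)
    then show "mps_nth (a * b) e = mps_nth (b * a) e"
      by (simp add: times_mps_def)
  qed
  show "1 * a = a"
  proof (rule mps_ext)
    fix e :: "'b \<Rightarrow> nat"
    have "(\<Sum>(u, v)\<in>exp_splits e. (if u = 0 then 1 else 0) * mps_nth a v) =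
          (\<Sum>(u, v)\<in>{(0 :: 'b \<Rightarrow> nat, e)}. (if u = 0 then 1 else 0) * mps_nth a v)"
    proof (rule sum.mono_neutral_right)
      show "finite (exp_splits e)" by simp
    qed (auto simp: exp_splits_def split: if_splits)
    then show "mps_nth (1 * a) e = mps_nth a e"
      by (simp add: times_mps_def one_mps_def)
  qed
  show "(a + b) * c = a * c + b * c"
    by (rule mps_ext)
       (simp add: times_mps_def plus_mps_def split_def distrib_right sum.distrib)
  show "(0 :: ('a, 'b) mps) \<noteq> 1"
  proof
    assume "(0 :: ('a, 'b) mps) = 1"
    then have "mps_nth (0 :: ('a, 'b) mps) 0 = mps_nth 1 0" by simp
    then show False by (simp add: zero_mps_def one_mps_def)
  qed
qed (auto intro!: mps_ext
      simp: plus_mps_def zero_mps_def minus_mps_def uminus_mps_def algebra_simps)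

end

definition mps_const :: "'k::zero \<Rightarrow> ('k, 'n) mps" where
  "mps_const c = Abs_mps (\<lambda>e. if e = 0 then c else 0)"


section \<open>Ideals, minimal primes, dimension, integrality\<close>

definition ring_ideal :: "'a::comm_ring_1 set \<Rightarrow> bool" where
  "ring_ideal J \<longleftrightarrow> 0 \<in> J \<and> (\<forall>x\<in>J. \<forall>y\<in>J. x + y \<in> J) \<and> (\<forall>a. \<forall>x\<in>J. a * x \<in> J)"

definition radical_ideal :: "'a::comm_ring_1 set \<Rightarrow> bool" where
  "radical_ideal J \<longleftrightarrow> ring_ideal J \<and> (\<forall>x m. x ^ m \<in> J \<longrightarrow> x \<in> J)"

definition prime_ideal :: "'a::comm_ring_1 set \<Rightarrow> bool" where
  "prime_ideal J \<longleftrightarrow> ring_ideal J \<and> J \<noteq> UNIV \<and> (\<forall>x y. x * y \<in> J \<longrightarrow> x \<in> J \<or> y \<in> J)"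

definition minimal_primes :: "'a::comm_ring_1 set \<Rightarrow> 'a set set" where
  "minimal_primes J = {P. prime_ideal P \<and> J \<subseteq> P \<and>
     (\<forall>P'. prime_ideal P' \<longrightarrow> J \<subseteq> P' \<longrightarrow> P' \<subseteq> P \<longrightarrow> P' = P)}"

text \<open>Krull dimension of the quotient by \<open>J\<close>; its primes are the primes containing \<open>J\<close>.\<close>

definition quot_krull_dim :: "'a::comm_ring_1 set \<Rightarrow> enat" where
  "quot_krull_dim J = (SUP m \<in> {m. \<exists>P :: nat \<Rightarrow> 'a set.
     (\<forall>i\<le>m. prime_ideal (P i) \<and> J \<subseteq> P i) \<and> (\<forall>i<m. P i \<subset> P (Suc i))}. enat m)"

definition integral_over :: "'a::comm_ring_1 set \<Rightarrow> 'a \<Rightarrow> bool" where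
  "integral_over A x \<longleftrightarrow>
     (\<exists>p :: 'a poly. lead_coeff p = 1 \<and> (\<forall>n. coeff p n \<in> A) \<and> poly p x = 0)"


section \<open>Algebroid curves\<close>

text \<open>
  The branches are indexed by the finite type \<open>'r\<close>. The total ring of fractions is the product
  of the fields of Laurent series \<open>'k fls\<close>, with the pointwise ring structure on functions.
\<close>

type_synonym ('k, 'r) total = "'r \<Rightarrow> 'k fls"

definition scal :: "'k::field \<Rightarrow> ('k, 'r) total \<Rightarrow> ('k, 'r) total" where
  "scal c f = (\<lambda>i. fls_const c * f i)"

text \<open>
  A parametrization of the branch \<open>P\<close>: an embedding of the residue ring by \<open>P\<close> into \<open>'k fls\<close>
  that makes \<open>'k fls\<close> its fraction field and the power series ring its integral closure there.
  It records the choice of a uniformizer \<open>t\<close>.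
\<close>

definition branch_param ::
    "('k::field, 'n::finite) mps set \<Rightarrow> (('k, 'n) mps \<Rightarrow> 'k fls) \<Rightarrow> bool" where
  "branch_param P \<phi> \<longleftrightarrow>
     (\<forall>p q. \<phi> (p + q) = \<phi> p + \<phi> q) \<and>
     (\<forall>p q. \<phi> (p * q) = \<phi> p * \<phi> q) \<and>
     (\<forall>c. \<phi> (mps_const c) = fls_const c) \<and>
     {p. \<phi> p = 0} = P \<and>
     (\<forall>x. \<exists>p q. \<phi> q \<noteq> 0 \<and> x = \<phi> p / \<phi> q) \<and>
     {x. integral_over (range \<phi>) x} = range fps_to_fls"

text \<open>The local ring and its maximal ideal, as subsets of the total ring of fractions.\<close>

definition emb :: "('r \<Rightarrow> ('k, 'n) mps \<Rightarrow> 'k fls) \<Rightarrow> ('k, 'n) mps \<Rightarrow> ('k, 'r) total" where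
  "emb \<phi> p = (\<lambda>i. \<phi> i p)"

definition loc_ring :: "('r \<Rightarrow> ('k, 'n) mps \<Rightarrow> 'k fls) \<Rightarrow> ('k, 'r) total set" where
  "loc_ring \<phi> = range (emb \<phi>)"

definition max_ideal ::
    "('r \<Rightarrow> ('k::field, 'n::finite) mps \<Rightarrow> 'k fls) \<Rightarrow> ('k, 'r) total set" where
  "max_ideal \<phi> = emb \<phi> ` {p. mps_nth p 0 = 0}"

definition max_ideal_sq ::
    "('r \<Rightarrow> ('k::field, 'n::finite) mps \<Rightarrow> 'k fls) \<Rightarrow> ('k, 'r) total set" where
  "max_ideal_sq \<phi> = {\<Sum>j<m. a j * b j | (m :: nat) a b.
     \<forall>j<m. a j \<in> max_ideal \<phi> \<and> b j \<in> max_ideal \<phi>}"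

text \<open>The quotient space \<open>V / W\<close> has a basis consisting of the classes of \<open>d\<close> vectors.\<close>

definition has_quot_dim ::
    "('k::field, 'r) total set \<Rightarrow> ('k, 'r) total set \<Rightarrow> nat \<Rightarrow> bool" where
  "has_quot_dim V W d \<longleftrightarrow> (\<exists>B\<subseteq>V. finite B \<and> card B = d \<and>
     (\<forall>c. (\<Sum>b\<in>B. scal (c b) b) \<in> W \<longrightarrow> (\<forall>b\<in>B. c b = 0)) \<and>
     (\<forall>x\<in>V. \<exists>c. x - (\<Sum>b\<in>B. scal (c b) b) \<in> W))"

definition algebroid_curve ::
    "('k::field, 'n::finite) mps set \<Rightarrow> ('r::finite \<Rightarrow> ('k, 'n) mps set) \<Rightarrow>
     ('r \<Rightarrow> ('k, 'n) mps \<Rightarrow> 'k fls) \<Rightarrow> bool" where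
  "algebroid_curve Q P \<phi> \<longleftrightarrow>
     radical_ideal Q \<and> Q \<noteq> UNIV \<and> quot_krull_dim Q = 1 \<and>
     inj P \<and> range P = minimal_primes Q \<and> Q = (\<Inter>i. P i) \<and>
     (\<forall>i. quot_krull_dim (P i) = 1) \<and>
     (\<forall>i. branch_param (P i) (\<phi> i)) \<and>
     has_quot_dim (max_ideal \<phi>) (max_ideal_sq \<phi>) CARD('n)"


section \<open>Values and fractional ideals\<close>

definition val :: "'r \<Rightarrow> ('k::zero, 'r) total \<Rightarrow> int extended" where
  "val i f = (if f i = 0 then Pinf else Fin (fls_subdegree (f i)))"

definition lin_span ::
    "('k::field, 'r) total set \<Rightarrow> ('k, 'r) total set \<Rightarrow> ('k, 'r) total set" where
  "lin_span A S = {\<Sum>h\<in>S. a h * h | a. \<forall>h\<in>S. a h \<in> A}"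

definition fractional_ideal ::
    "('r \<Rightarrow> ('k::field, 'n) mps \<Rightarrow> 'k fls) \<Rightarrow> ('k, 'r) total set \<Rightarrow> bool" where
  "fractional_ideal \<phi> J \<longleftrightarrow>
     (\<exists>S. finite S \<and> J = lin_span (loc_ring \<phi>) S) \<and>
     (\<exists>x\<in>J. \<forall>y. x * y = 0 \<longrightarrow> y = 0)"

definition branch_part :: "('k::field, 'r) total set \<Rightarrow> 'r \<Rightarrow> ('k, 'r) total set" where
  "branch_part J i = {f \<in> J. \<forall>j. j \<noteq> i \<longrightarrow> val j f = Pinf}"

definition conductor :: "int extended set \<Rightarrow> int" where
  "conductor V = (THE c. (\<forall>m :: nat. Fin (c + int m) \<in> V) \<and> Pinf \<in> V \<and> Fin (c - 1) \<notin> V)"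

definition kappa :: "('k::field, 'r) total set \<Rightarrow> 'r \<Rightarrow> int" where
  "kappa J i = conductor (val i ` branch_part J i)"


section \<open>Reductions and Standard Bases\<close>

definition gprod :: "('k::field, 'r) total set \<Rightarrow> (('k, 'r) total \<Rightarrow> nat) \<Rightarrow> ('k, 'r) total" where
  "gprod G \<alpha> = (\<Prod>g\<in>G. g ^ \<alpha> g)"

definition k_reduction ::
    "'r \<Rightarrow> ('k::field, 'r) total set \<Rightarrow> ('k, 'r) total set \<Rightarrow>
     ('k, 'r) total \<Rightarrow> ('k, 'r) total \<Rightarrow> bool" where
  "k_reduction k H G f f' \<longleftrightarrow> f \<noteq> 0 \<and> val k f \<noteq> Pinf \<and>
     (\<exists>c. \<exists>h\<in>H. \<exists>\<alpha>. f' = f - scal c (gprod G \<alpha> * h)) \<and>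
     (\<forall>i. val i f' \<ge> val i f) \<and> val k f' > val k f"

definition reduction ::
    "('k::field, 'r) total set \<Rightarrow> ('k, 'r) total set \<Rightarrow>
     ('k, 'r) total \<Rightarrow> ('k, 'r) total \<Rightarrow> bool" where
  "reduction H G f f' \<longleftrightarrow> (\<exists>k. k_reduction k H G f f')"

definition final_reduction ::
    "('k::field, 'r) total set \<Rightarrow> ('k, 'r) total set \<Rightarrow>
     ('k, 'r) total \<Rightarrow> ('k, 'r) total \<Rightarrow> bool" where
  "final_reduction H G f f' \<longleftrightarrow> f \<noteq> 0 \<and>
     ((reduction H G)\<^sup>*\<^sup>* f f' \<or>
      (\<exists>F. F 0 = f \<and> (\<forall>j. reduction H G (F j) (F (Suc j))) \<and>
           (\<forall>i. (\<lambda>j. F j i) \<longlonglongrightarrow> f' i))) \<and>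
     \<not> (\<exists>f''. reduction H G f' f'')"

definition standard_basis_ring ::
    "('r \<Rightarrow> ('k::field, 'n::finite) mps \<Rightarrow> 'k fls) \<Rightarrow> ('k, 'r) total set \<Rightarrow> bool" where
  "standard_basis_ring \<phi> G \<longleftrightarrow> finite G \<and> G \<subseteq> max_ideal \<phi> - {0} \<and>
     (\<forall>f \<in> loc_ring \<phi>. f \<noteq> 0 \<longrightarrow> (\<exists>f'. reduction {1} G f f'))"

definition standard_basis ::
    "('k::field, 'r) total set \<Rightarrow> ('k, 'r) total set \<Rightarrow> ('k, 'r) total set \<Rightarrow> bool" where
  "standard_basis G J H \<longleftrightarrow> finite H \<and> H \<subseteq> J - {0} \<and>
     (\<forall>f \<in> J. f \<noteq> 0 \<longrightarrow> (\<exists>f'. reduction H G f f'))"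

text \<open>The image of \<open>B\<close> on the branch \<open>i\<close> is a Standard Basis for the image of \<open>branch_part J i\<close>.\<close>

definition branch_standard_basis ::
    "('k::field, 'r) total set \<Rightarrow> ('k, 'r) total set \<Rightarrow> 'r \<Rightarrow> ('k, 'r) total set \<Rightarrow> bool" where
  "branch_standard_basis G J i B \<longleftrightarrow> finite B \<and> B \<subseteq> branch_part J i - {0} \<and>
     (\<forall>f \<in> branch_part J i. f \<noteq> 0 \<longrightarrow> (\<exists>h\<in>B. \<exists>\<alpha>. val i f = val i (gprod G \<alpha> * h)))"


section \<open>The procedure\<close>

definition s_process ::
    "'r \<Rightarrow> ('k::field, 'r) total set \<Rightarrow> ('k, 'r) total set \<Rightarrow> ('k, 'r) total \<Rightarrow> bool" where
  "s_process k H G f \<longleftrightarrow> (\<exists>c1 c2. \<exists>h1\<in>H. \<exists>h2\<in>H. \<exists>\<alpha>1 \<alpha>2.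
     f = scal c1 (gprod G \<alpha>1 * h1) + scal c2 (gprod G \<alpha>2 * h2) \<and>
     val k f > min (val k (gprod G \<alpha>1 * h1)) (val k (gprod G \<alpha>2 * h2)))"

definition relevant_s_processes ::
    "('k::field, 'r) total set \<Rightarrow> ('k, 'r) total set \<Rightarrow> ('r \<Rightarrow> int) \<Rightarrow> ('k, 'r) total set" where
  "relevant_s_processes H G \<rho> = {f. (\<exists>k. s_process k H G f) \<and> (\<exists>i. val i f < Fin (\<rho> i))}"

text \<open>\<open>S\<close> contains exactly one element of each class of \<open>F\<close> modulo nonzero scalars.\<close>

definition scalar_representatives ::
    "('k::field, 'r) total set \<Rightarrow> ('k, 'r) total set \<Rightarrow> bool" where
  "scalar_representatives F S \<longleftrightarrow> S \<subseteq> F \<and> (\<forall>f\<in>F. \<exists>!s. s \<in> S \<and> (\<exists>c. c \<noteq> 0 \<and> f = scal c s))"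

text \<open>
  One pass through the four steps, leading from \<open>H\<close> to \<open>H'\<close>. It is a relation, since the bound
  \<open>\<rho>\<close>, the representatives \<open>S\<close> and the final reductions \<open>R\<close> are not determined by \<open>H\<close>.
\<close>

definition iteration ::
    "('k::field, 'r) total set \<Rightarrow> ('k, 'r) total set \<Rightarrow>
     ('k, 'r) total set \<Rightarrow> ('k, 'r) total set \<Rightarrow> bool" where
  "iteration G J H H' \<longleftrightarrow> (\<exists>\<rho> S R.
     (\<forall>i. kappa J i \<le> \<rho> i) \<and>
     scalar_representatives (relevant_s_processes H G \<rho>) S \<and>
     (\<forall>f\<in>S. final_reduction H G f (R f)) \<and>
     H' = H \<union> (R ` S - {0}))"

text \<open>A pass after which the procedure does not stop.\<close>

definition continuing_iteration ::
    "('k::field, 'r) total set \<Rightarrow> ('k, 'r) total set \<Rightarrow>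
     ('k, 'r) total set \<Rightarrow> ('k, 'r) total set \<Rightarrow> bool" where
  "continuing_iteration G J H H' \<longleftrightarrow> iteration G J H H' \<and> H' \<noteq> H"

end

theory Submission
  imports Defs
begin

text \<open>
  A branch contains all power series of sufficiently large order, because the uniformizer is
  a quotient of elements of the branch and satisfies a monic equation over it. Hence \<open>J\<close> contains
  all tuples of large value; it is closed, and \<open>\<kappa>\<close> exists. The procedure stops because an
  irreducible nonzero element has all its finite values below \<open>\<kappa>\<close>, and because an element is
  reduced by every element of \<open>H\<close> with the same values. For the output \<open>H\<close>, represent
  an irreducible \<open>f\<close> by terms \<open>G\<^sup>\<alpha> h\<close>. Where the terms of minimal value on branch \<open>k\<close> cancel, they
  are combinations of \<open>S\<^sub>k\<close>-processes, and these have representations without cancellation. So the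
  minimal values can be raised until they reach those of \<open>f\<close>, and then one of the terms reduces \<open>f\<close>.
\<close>

text \<open>Parametrizations are only ring homomorphisms on power series, without assumed
  continuity, so they cannot be applied to an infinite sum term by term; remainders are shown to be
  divisible by arbitrarily high powers of an element of positive value instead. The elements of
  \<open>B i\<close> are supported on one branch and can correct one component without disturbing
  the others. This is why no finite value from \<kappa> on survives reduction, and why S-processes
  of large value need not be computed. The obstacle in the correctness proof is a branch on which
  \<open>f\<close> vanishes: bounds on values are raised by one at a time and never reach infinity,
  and a term of high but finite value there does not reduce \<open>f\<close>. Local finiteness
  closes this gap: a term of small value on one branch has bounded finite values on all
  branches.\<close>

notation fls_nth (infixl "$$" 75)

section \<open>Power series in one element of the maximal ideal\<close>

lemma mps_nth_times:
  "mps_nth (p * q :: ('k::comm_ring_1, 'n::finite) mps) e = (\<Sum>(u, v)\<in>exp_splits e. mps_nth p u * mps_nth q v)"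
  by (simp add: times_mps_def)

lemma mps_nth_const_times [simp]:
  "mps_nth (mps_const c * q :: ('k::comm_ring_1, 'n::finite) mps) e = c * mps_nth q e"
proof -
  have "(\<Sum>(u, v)\<in>exp_splits e. mps_nth (mps_const c) u * mps_nth q v) =
        (\<Sum>(u, v)\<in>{(0 :: 'n \<Rightarrow> nat, e)}. mps_nth (mps_const c) u * mps_nth q v)"
  proof (rule sum.mono_neutral_right)
    show "finite (exp_splits e)" by simp
  qed (auto simp: mps_const_def exp_splits_def split: if_splits)
  then show ?thesis by (simp add: mps_nth_times mps_const_def)
qed

text \<open>Each factor \<open>p\<close> takes at least 1 of the total degree, so only finitely many
  powers of \<open>p\<close> contribute to a given coefficient.\<close>

lemma mps_power_nth_eq_0:
  fixes p :: "('k::comm_ring_1, 'n::finite) mps"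
  assumes p: "mps_nth p 0 = 0"
  shows "sum e UNIV < a \<Longrightarrow> mps_nth (p ^ a) e = 0"
proof (induction a arbitrary: e)
  case (Suc a)
  have "mps_nth p u * mps_nth (p ^ a) v = 0" if "(u, v) \<in> exp_splits e" for u v
  proof (cases "u = 0")
    case False
    then have "sum u UNIV > 0" by (auto simp: fun_eq_iff intro: sum_pos2)
    moreover have "sum e UNIV = sum u UNIV + sum v UNIV"
      using that by (auto simp: exp_splits_def sum.distrib)
    ultimately show ?thesis using Suc by simp
  qed (simp add: p)
  then show ?case by (auto simp: mps_nth_times intro!: sum.neutral)
qed simp

text \<open>\<open>T s\<close> is the series \<open>\<Sum>a. s a * p ^ a\<close>; stating only its recursion
  makes every ring homomorphism respect it, without any topology.\<close>

lemma mps_series_exists: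
  fixes p :: "('k::comm_ring_1, 'n::finite) mps"
  assumes p: "mps_nth p 0 = 0"
  obtains T where "\<And>s. T s = mps_const (s 0) + p * T (\<lambda>a. s (Suc a))"
proof
  define T :: "(nat \<Rightarrow> 'k) \<Rightarrow> ('k, 'n) mps" where
    "T s = Abs_mps (\<lambda>e. \<Sum>a\<le>sum e UNIV. s a * mps_nth (p ^ a) e)" for s
  \<comment> \<open>Summing further adds only zeros, so the total degree of \<open>e\<close> can
    serve as a common bound for all parts \<open>v\<close> of a splitting of
    \<open>e\<close>.\<close>
  have extend: "mps_nth (T s) v = (\<Sum>a\<le>d. s a * mps_nth (p ^ a) v)" if "sum v UNIV \<le> d" for s v d
    unfolding T_def mps_nth_Abs
    by (rule sum.mono_neutral_left) (use that in \<open>auto simp: mps_power_nth_eq_0[OF p]\<close>)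
  fix s
  show "T s = mps_const (s 0) + p * T (\<lambda>a. s (Suc a))"
  proof (rule mps_ext)
    fix e :: "'n \<Rightarrow> nat"
    let ?d = "sum e UNIV"
    have "mps_nth (p * T (\<lambda>a. s (Suc a))) e =
        (\<Sum>(u, v)\<in>exp_splits e. mps_nth p u * (\<Sum>a\<le>?d. s (Suc a) * mps_nth (p ^ a) v))"
      unfolding mps_nth_times
      by (rule sum.cong) (auto simp: exp_splits_def sum.distrib intro!: arg_cong2[where f = "(*)"] extend)
    also have "\<dots> = (\<Sum>a\<le>?d. s (Suc a) * mps_nth (p ^ Suc a) e)"
      by (simp add: mps_nth_times sum_distrib_left split_def mult_ac) (rule sum.swap)
    also have "\<dots> = (\<Sum>a\<le>Suc ?d. if a = 0 then 0 else s a * mps_nth (p ^ a) e)"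
      by (subst sum.atMost_Suc_shift) simp
    also have "\<dots> = (\<Sum>a\<le>?d. if a = 0 then 0 else s a * mps_nth (p ^ a) e)"
      using mps_power_nth_eq_0[OF p, of e "Suc ?d"] by simp
    finally have "mps_nth (p * T (\<lambda>a. s (Suc a))) e = \<dots>" .
    moreover have "(\<Sum>a\<le>?d. s a * mps_nth (p ^ a) e) =
        s 0 * mps_nth 1 e + (\<Sum>a\<le>?d. if a = 0 then 0 else s a * mps_nth (p ^ a) e)"
      by (simp add: sum.atMost_shift)
    ultimately show "mps_nth (T s) e = mps_nth (mps_const (s 0) + p * T (\<lambda>a. s (Suc a))) e"
      unfolding T_def by (simp add: plus_mps_def one_mps_def mps_const_def)
  qed
qed

text \<open>Scaled to constant term 1 the series is \<open>1 - x\<close> with \<open>x\<close> free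
  of a constant term. The geometric series in \<open>x\<close>, given by the constant sequence 1,
  inverts it: its recursion is the equation of an inverse.\<close>

lemma mps_unit_exists:
  fixes p :: "('k::field, 'n::finite) mps"
  assumes "mps_nth p 0 \<noteq> 0"
  obtains q where "p * q = 1"
proof -
  define c where "c = mps_const (inverse (mps_nth p 0)) * p"
  have "mps_nth (1 - c) 0 = 0"
    using assms by (simp add: c_def minus_mps_def one_mps_def)
  then obtain T where "\<And>s. T s = mps_const (s 0) + (1 - c) * T (\<lambda>a. s (Suc a))"
    by (rule mps_series_exists) blast
  from this[of "\<lambda>_. 1"] have "T (\<lambda>_. 1) = 1 + (1 - c) * T (\<lambda>_. 1)"
    by (simp add: mps_const_def one_mps_def)
  then have "c * T (\<lambda>_. 1) = 1"
    by (simp add: algebra_simps)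
  then show ?thesis
    using that by (metis c_def mult.commute mult.left_commute)
qed

section \<open>Valuations\<close>

definition fls_val :: "'k::zero fls \<Rightarrow> int extended" where
  "fls_val x = (if x = 0 then Pinf else Fin (fls_subdegree x))"

lemma val_eq_fls_val: "val i f = fls_val (f i)"
  by (simp add: val_def fls_val_def)

lemma fls_val_ge_iff: "Fin n \<le> fls_val x \<longleftrightarrow> (\<forall>m<n. x $$ m = 0)"
  by (auto simp: fls_val_def intro: fls_subdegree_geI)

lemma fls_val_eq_Fin_iff: "fls_val x = Fin n \<longleftrightarrow> x $$ n \<noteq> 0 \<and> (\<forall>m<n. x $$ m = 0)"
  by (auto simp: fls_val_def intro: fls_subdegree_eqI)

lemma fls_val_eq_Pinf_iff [simp]: "fls_val x = Pinf \<longleftrightarrow> x = 0"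
  by (simp add: fls_val_def)

text \<open>Turns a comparison with any extended bound, infinite ones included, into vanishing
  coefficients, so that the ultrametric inequalities follow coefficientwise.\<close>

lemma le_fls_val_iff: "a \<le> fls_val x \<longleftrightarrow> (\<forall>n. Fin n \<le> a \<longrightarrow> (\<forall>m<n. x $$ m = 0))"
proof (cases a)
  case (Fin n)
  then show ?thesis unfolding Fin less_eq_extended.simps fls_val_ge_iff by auto
next
  case Pinf
  have "x = 0" if "\<forall>n. \<forall>m<n. x $$ m = 0"
    using that by (intro fls_eqI) (metis fls_zero_nth lt_ex gt_ex)
  then show ?thesis using Pinf by auto
qed auto

lemma fls_val_add: "a \<le> fls_val x \<Longrightarrow> a \<le> fls_val y \<Longrightarrow> a \<le> fls_val (x + y :: 'k::group_add fls)"
  unfolding le_fls_val_iff by simp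

lemma fls_val_diff: "a \<le> fls_val x \<Longrightarrow> a \<le> fls_val y \<Longrightarrow> a \<le> fls_val (x - y :: 'k::group_add fls)"
  unfolding le_fls_val_iff by simp

lemma fls_val_sum:
  "(\<And>x. x \<in> A \<Longrightarrow> a \<le> fls_val (F x)) \<Longrightarrow> a \<le> fls_val (\<Sum>x\<in>A. F x :: 'k::ab_group_add fls)"
  by (induction A rule: infinite_finite_induct) (auto intro: fls_val_add simp: fls_val_def[of 0])

lemma fls_val_power: "x \<noteq> 0 \<Longrightarrow> fls_val (x ^ n) = Fin (int n * fls_subdegree (x :: 'k::field fls))"
  by (simp add: fls_val_def fls_subdegree_pow)

lemma fls_val_const_mult_ge: "a \<le> fls_val x \<Longrightarrow> a \<le> fls_val (fls_const c * x :: 'k::field fls)"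
  unfolding le_fls_val_iff by simp

lemma fls_val_const_mult [simp]: "c \<noteq> 0 \<Longrightarrow> fls_val (fls_const c * x) = fls_val (x :: 'k::field fls)"
  by (simp add: fls_val_def)

lemma fls_val_mult_ge:
  "Fin a \<le> fls_val x \<Longrightarrow> Fin b \<le> fls_val y \<Longrightarrow> Fin (a + b) \<le> fls_val (x * y :: 'k::field fls)"
  by (auto simp: fls_val_def split: if_splits)

lemma fls_eq_0_if_fls_val_ge: "(\<And>n::nat. Fin (int n + a) \<le> fls_val x) \<Longrightarrow> x = 0"
proof (rule ccontr)
  assume *: "\<And>n::nat. Fin (int n + a) \<le> fls_val x" and x: "x \<noteq> 0"
  show False
    using *[of "nat (fls_subdegree x - a + 1)"] x by (simp add: fls_val_def split: if_splits)
qed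

lemma fls_val_cancel:
  assumes "fls_val x = Fin n" "fls_val y = Fin n"
  shows "Fin n < fls_val (x - fls_const (x $$ n / y $$ n) * (y :: 'k::field fls))"
proof -
  have "Fin (n + 1) \<le> fls_val (x - fls_const (x $$ n / y $$ n) * y)"
    unfolding fls_val_ge_iff using assms[unfolded fls_val_eq_Fin_iff] by (auto simp: zless_add1_eq order.order_iff_strict)
  then show ?thesis by (rule less_le_trans[rotated]) simp
qed

text \<open>Links the metric limits of \<open>final_reduction\<close> to values, the form in which
  limits are used later.\<close>

lemma fls_tendsto_iff:
  "X \<longlonglongrightarrow> (L :: 'k::group_add fls) \<longleftrightarrow> (\<forall>n. \<exists>J. \<forall>j\<ge>J. Fin n \<le> fls_val (L - X j))"
proof
  assume X: "X \<longlonglongrightarrow> L"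
  show "\<forall>n. \<exists>J. \<forall>j\<ge>J. Fin n \<le> fls_val (L - X j)"
  proof
    fix n :: int
    have "\<forall>\<^sub>F j in sequentially. dist (X j) L < inverse (2 ^ nat n)"
      using X by (rule tendstoD) simp
    moreover have "Fin n \<le> fls_val (L - X j)" if d: "dist (X j) L < inverse (2 ^ nat n)" for j
    proof (cases "L = X j")
      case False
      \<comment> \<open>A distance below 1 excludes a negative order of the difference, so
        \<open>nat\<close> truncates nothing there.\<close>
      have "inverse (2 ^ nat n) \<le> (1::real)" by (simp add: inverse_le_1_iff)
      then have dd: "fls_subdegree (X j - L) \<ge> 0"
        using d False one_le_power[of "2::real"] by (auto simp: dist_fls_def split: if_splits) (smt (verit) one_le_power)
      then have "(2::real) ^ nat n < 2 ^ nat (fls_subdegree (X j - L))"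
        using d False by (auto simp: dist_fls_def split: if_splits)
      then have "nat n < nat (fls_subdegree (X j - L))" by simp
      then show ?thesis using False by (auto simp: fls_val_def fls_subdegree_minus_sym[of L])
    qed (simp add: fls_val_def)
    ultimately show "\<exists>J. \<forall>j\<ge>J. Fin n \<le> fls_val (L - X j)"
      unfolding eventually_sequentially by meson
  qed
next
  assume *: "\<forall>n. \<exists>J. \<forall>j\<ge>J. Fin n \<le> fls_val (L - X j)"
  show "X \<longlonglongrightarrow> L"
  proof (rule metric_LIMSEQ_I)
    fix e :: real assume "0 < e"
    then obtain n where n: "inverse (2 ^ n) < e"
      using real_arch_pow_inv[of e "1/2"] by (auto simp: power_one_over inverse_eq_divide)
    obtain J where J: "\<And>j. j \<ge> J \<Longrightarrow> Fin (int n) \<le> fls_val (L - X j)" using * by meson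
    have "dist (X j) L < e" if "j \<ge> J" for j
    proof (cases "X j = L")
      case False
      then have "int n \<le> fls_subdegree (X j - L)"
        using J[OF that] by (auto simp: fls_val_def fls_subdegree_minus_sym[of L] split: if_splits)
      then have "dist (X j) L \<le> inverse (2 ^ n)"
        using False by (simp add: dist_fls_def le_nat_iff)
      then show ?thesis using n by simp
    qed (use \<open>0 < e\<close> in simp)
    then show "\<exists>J. \<forall>j\<ge>J. dist (X j) L < e" by blast
  qed
qed

section \<open>The conductor of a branch\<close>

lemma fls_val_ge_0_iff: "Fin 0 \<le> fls_val x \<longleftrightarrow> x \<in> range fps_to_fls"
proof
  assume "Fin 0 \<le> fls_val x"
  then have "fps_to_fls (fls_regpart x) = x"
    by (intro fls_eqI) (auto simp: fls_val_ge_iff)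
  then show "x \<in> range fps_to_fls" by (metis rangeI)
qed (auto simp: fls_val_def fls_subdegree_fls_to_fps)

lemma integral_over_self:
  assumes "a \<in> A" "1 \<in> A" "0 \<in> A" "- a \<in> A"
  shows "integral_over A a"
  unfolding integral_over_def
proof (intro exI conjI allI)
  show "coeff [:- a, 1:] n \<in> A" for n
    using assms by (auto simp: coeff_pCons split: nat.split)
qed auto

locale branch =
  fixes \<psi> :: "('k::field, 'n::finite) mps \<Rightarrow> 'k fls"
  assumes add: "\<psi> (p + q) = \<psi> p + \<psi> q"
    and mult: "\<psi> (p * q) = \<psi> p * \<psi> q"
    and const: "\<psi> (mps_const c) = fls_const c"
    and fraction: "\<exists>p q. \<psi> q \<noteq> 0 \<and> x = \<psi> p / \<psi> q"
    and integral: "integral_over (range \<psi>) x \<longleftrightarrow> x \<in> range fps_to_fls"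
begin

lemma zero [simp]: "\<psi> 0 = 0"
  by (metis add add_cancel_right_right add_0)

lemma one [simp]: "\<psi> 1 = 1"
  using const[of 1] by (simp add: mps_const_def one_mps_def)

lemma minus [simp]: "\<psi> (- p) = - \<psi> p"
  using add[of p "- p"] by (simp add: add_eq_0_iff)

lemma diff: "\<psi> (p - q) = \<psi> p - \<psi> q"
  using add[of p "- q"] by simp

lemma power: "\<psi> (p ^ n) = \<psi> p ^ n"
  by (induction n) (simp_all add: mult)

lemma sum: "\<psi> (\<Sum>a\<in>A. F a) = (\<Sum>a\<in>A. \<psi> (F a))"
  by (induction A rule: infinite_finite_induct) (simp_all add: add)

lemma range_mult: "x \<in> range \<psi> \<Longrightarrow> y \<in> range \<psi> \<Longrightarrow> x * y \<in> range \<psi>"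
  by (auto simp flip: mult)

lemma range_power: "x \<in> range \<psi> \<Longrightarrow> x ^ n \<in> range \<psi>"
  by (auto simp flip: power)

lemma range_uminus: "x \<in> range \<psi> \<Longrightarrow> - x \<in> range \<psi>"
  by (auto simp del: minus simp flip: minus)

lemma range_sum: "(\<And>a. a \<in> A \<Longrightarrow> F a \<in> range \<psi>) \<Longrightarrow> (\<Sum>a\<in>A. F a) \<in> range \<psi>"
proof (induction A rule: infinite_finite_induct)
  case (insert a A)
  then obtain p q where "F a = \<psi> p" "(\<Sum>a\<in>A. F a) = \<psi> q" by blast
  with insert show ?case by (simp flip: add)
qed (auto intro: range_eqI[of _ _ 0])

text \<open>An element of the branch is integral over the branch, hence a power series.\<close>

lemma val_ge_0: "Fin 0 \<le> fls_val (\<psi> p)"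
  unfolding fls_val_ge_0_iff integral[symmetric]
  by (rule integral_over_self) (auto intro: range_eqI[of _ _ 0] range_eqI[of _ _ 1] range_uminus)

text \<open>If the value were \<open>0\<close>, subtracting the constant term of \<open>\<psi> p\<close> from \<open>p\<close> would give a unit
  of positive value.\<close>

lemma val_ge_1:
  assumes "mps_nth p 0 = 0"
  shows "Fin 1 \<le> fls_val (\<psi> p)"
proof (rule ccontr)
  define a where "a = \<psi> p $$ 0"
  have ge0: "\<And>m. m < 0 \<Longrightarrow> \<psi> p $$ m = 0"
    using val_ge_0[of p] unfolding fls_val_ge_iff by blast
  assume "\<not> Fin 1 \<le> fls_val (\<psi> p)"
  then obtain m where "m < 1" "\<psi> p $$ m \<noteq> 0" unfolding fls_val_ge_iff by blast
  then have a: "a \<noteq> 0" using ge0[of m] by (cases "m = 0") (auto simp: a_def)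
  have "mps_nth (p - mps_const a) 0 \<noteq> 0"
    using assms a by (simp add: minus_mps_def mps_const_def)
  then obtain q where "(p - mps_const a) * q = 1" by (rule mps_unit_exists)
  then have q: "(\<psi> p - fls_const a) * \<psi> q = 1"
    by (simp flip: const diff mult)
  have "Fin 1 \<le> fls_val (\<psi> p - fls_const a)"
    unfolding fls_val_ge_iff by (auto simp: a_def intro: ge0)
  then have "Fin (1 + 0) \<le> fls_val ((\<psi> p - fls_const a) * \<psi> q)"
    by (rule fls_val_mult_ge) (rule val_ge_0)
  then show False by (simp add: q fls_val_def)
qed

text \<open>If the uniformizer is \<open>a / q\<close> and satisfies a monic equation of degree \<open>d\<close>,
  then \<open>q ^ d\<close> is a common denominator of all its powers.\<close>

lemma uniformizer_denominator:
  obtains u where "u \<in> range \<psi>" "u \<noteq> 0" "\<And>m. u * fls_X ^ m \<in> range \<psi>"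
proof -
  obtain a q where q: "\<psi> q \<noteq> 0" and X: "fls_X = \<psi> a / \<psi> q" using fraction by blast
  have "fls_X = (fps_to_fls fps_X :: 'k fls)" by simp
  then have "integral_over (range \<psi>) fls_X" unfolding integral by blast
  then obtain p where lc: "lead_coeff p = 1" and co: "\<And>n. coeff p n \<in> range \<psi>" and "poly p fls_X = 0"
    unfolding integral_over_def by blast
  define d where "d = degree p"
  have root: "fls_X ^ d = - (\<Sum>j<d. coeff p j * fls_X ^ j)"
    using \<open>poly p fls_X = 0\<close> lc by (simp add: poly_altdef d_def lessThan_Suc_atMost[symmetric] add_eq_0_iff)
  have "\<psi> q ^ d * fls_X ^ m \<in> range \<psi>" for m
  proof (induction m rule: less_induct)
    case (less m)
    show ?case
    proof (cases "m < d")
      case True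
      then have "\<psi> q ^ d * fls_X ^ m = \<psi> q ^ (d - m) * \<psi> a ^ m"
        using q by (simp add: X power_divide power_diff)
      then show ?thesis by (simp add: range_mult range_power)
    next
      case False
      then have "\<psi> q ^ d * fls_X ^ m = \<psi> q ^ d * fls_X ^ (m - d) * fls_X ^ d"
        by (simp add: mult.assoc flip: power_add)
      also have "\<dots> = - (\<Sum>j<d. coeff p j * (\<psi> q ^ d * fls_X ^ (m - d + j)))"
        unfolding root by (simp add: sum_distrib_left power_add mult_ac)
      also have "\<dots> \<in> range \<psi>"
        using False by (intro range_uminus range_sum range_mult co less.IH) auto
      finally show ?thesis .
    qed
  qed
  then show ?thesis using q by (intro that[of "\<psi> q ^ d"]) (auto intro: range_power)
qed

text \<open>With \<open>N\<close> the order of the common denominator \<open>u\<close>, the series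
  of order at least \<open>N\<close> form a module over the power series in one element
  \<open>p\<close>, generated by the finitely many \<open>u * fls_X ^ b\<close> with
  \<open>b < e\<close>: splitting off these and dividing by \<open>\<psi> p\<close> can be repeated
  forever, and the constants collected are the coefficients of \<open>e\<close> series in
  \<open>p\<close>.\<close>

lemma conductor_exists:
  obtains N where "\<And>x. Fin N \<le> fls_val x \<Longrightarrow> x \<in> range \<psi>"
proof -
  obtain u where u: "u \<in> range \<psi>" "u \<noteq> 0" and uX: "\<And>m. u * fls_X ^ m \<in> range \<psi>"
    using uniformizer_denominator by blast
  define N where "N = fls_subdegree u"
  have "N \<ge> 0"
    using u val_ge_0 by (metis N_def fls_val_def imageE less_eq_extended.simps(1))
  obtain p where p: "\<psi> p = u * fls_X" using uX[of 1] by auto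
  \<comment> \<open>The extra factor \<open>fls_X\<close> makes the order \<open>e\<close> of
    \<open>\<psi> p\<close> positive even if \<open>u\<close> has order 0; a unit has value 0, so
    \<open>p\<close> has no constant term.\<close>
  define e where "e = nat (N + 1)"
  have e: "int e = N + 1" using \<open>N \<ge> 0\<close> by (simp add: e_def)
  have x: "fls_val (\<psi> p) = Fin (int e)"
    using u e by (simp add: p fls_val_def N_def)
  have p0: "mps_nth p 0 = 0"
  proof (rule ccontr)
    assume "mps_nth p 0 \<noteq> 0"
    then obtain q where "p * q = 1" by (rule mps_unit_exists)
    then have "\<psi> p * \<psi> q = 1" by (simp flip: mult)
    moreover have "Fin (int e + 0) \<le> fls_val (\<psi> p * \<psi> q)"
      by (rule fls_val_mult_ge) (simp_all add: x val_ge_0)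
    ultimately show False using e \<open>N \<ge> 0\<close> by (simp add: fls_val_def)
  qed
  define U where "U b = (SOME q. \<psi> q = u * fls_X ^ b)" for b
  have U: "\<psi> (U b) = u * fls_X ^ b" for b
    unfolding U_def using uX[of b] by (intro someI_ex[of "\<lambda>q. \<psi> q = u * fls_X ^ b"]) auto
  have valU: "fls_val (\<psi> (U b)) = Fin (N + int b)" for b
    using u by (simp add: U fls_val_def N_def)
  \<comment> \<open>The \<open>\<psi> (U b)\<close> have the consecutive orders
    \<open>N + b\<close>, so leading coefficients can be removed one at a time.\<close>
  have truncate: "\<exists>c. Fin (N + int b) \<le> fls_val (y - (\<Sum>b<b. fls_const (c b) * \<psi> (U b)))"
    if y: "Fin N \<le> fls_val y" for y b
  proof (induction b)
    case 0
    then show ?case using y by simp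
  next
    case (Suc b)
    then obtain c where c: "Fin (N + int b) \<le> fls_val (y - (\<Sum>b<b. fls_const (c b) * \<psi> (U b)))" (is "_ \<le> fls_val ?z")
      by blast
    define c' where "c' = c(b := ?z $$ (N + int b) / \<psi> (U b) $$ (N + int b))"
    have "y - (\<Sum>b<Suc b. fls_const (c' b) * \<psi> (U b)) = ?z - fls_const (c' b) * \<psi> (U b)"
      by (simp add: c'_def)
    moreover have "Fin (N + int (Suc b)) \<le> fls_val (?z - fls_const (c' b) * \<psi> (U b))"
      unfolding fls_val_ge_iff
    proof (intro allI impI)
      fix m assume "m < N + int (Suc b)"
      then consider "m < N + int b" | "m = N + int b" by fastforce
      then show "(?z - fls_const (c' b) * \<psi> (U b)) $$ m = 0"
        by cases (use c valU[of b] in \<open>auto simp: fls_val_ge_iff fls_val_eq_Fin_iff c'_def\<close>)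
    qed
    ultimately show ?case by metis
  qed
  have "\<exists>c y'. Fin N \<le> fls_val y' \<and> y = (\<Sum>b<e. fls_const (c b) * \<psi> (U b)) + \<psi> p * y'"
    if y: "Fin N \<le> fls_val y" for y
  proof -
    obtain c where c: "Fin (N + int e) \<le> fls_val (y - (\<Sum>b<e. fls_const (c b) * \<psi> (U b)))" (is "_ \<le> fls_val ?z")
      using truncate[OF y] by blast
    have nz: "\<psi> p \<noteq> 0" using x by (auto simp: fls_val_def)
    \<comment> \<open>Removing \<open>e\<close> coefficients raises the order to
      \<open>N + e\<close>, and dividing by \<open>\<psi> p\<close> of order \<open>e\<close>
      returns to \<open>N\<close>.\<close>
    then have "Fin N \<le> fls_val (?z / \<psi> p)"
      using c x by (auto simp: fls_val_def fls_divide_subdegree split: if_splits)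
    moreover have "y = (\<Sum>b<e. fls_const (c b) * \<psi> (U b)) + \<psi> p * (?z / \<psi> p)"
      using nz by simp
    ultimately show ?thesis by blast
  qed
  then obtain C Y where Y: "\<And>y. Fin N \<le> fls_val y \<Longrightarrow> Fin N \<le> fls_val (Y y)"
    and eq: "\<And>y. Fin N \<le> fls_val y \<Longrightarrow> y = (\<Sum>b<e. fls_const (C y b) * \<psi> (U b)) + \<psi> p * Y y"
    by metis
  obtain T where T: "\<And>s. T s = mps_const (s 0) + p * T (\<lambda>a. s (Suc a))"
    using mps_series_exists[OF p0] by blast
  show ?thesis
  proof
    fix y :: "'k fls" assume y: "Fin N \<le> fls_val y"
    \<comment> \<open>\<open>s k b\<close> lists the constants at \<open>U b\<close> from the
      \<open>k\<close>-th quotient on, and \<open>y' k\<close> is the error of the resulting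
      representation of that quotient.\<close>
    define s where "s k b = (\<lambda>a. C ((Y ^^ (k + a)) y) b)" for k b
    define y' where "y' k = (Y ^^ k) y - (\<Sum>b<e. \<psi> (T (s k b)) * \<psi> (U b))" for k
    have Yk: "Fin N \<le> fls_val ((Y ^^ k) y)" for k
      by (induction k) (use y Y in auto)
    \<comment> \<open>The errors are power series, so this recursion makes \<open>y' 0\<close>
      divisible by every power of \<open>\<psi> p\<close>, which forces it to be 0.\<close>
    have rec: "y' k = \<psi> p * y' (Suc k)" for k
    proof -
      have "\<psi> (T (s k b)) = fls_const (C ((Y ^^ k) y) b) + \<psi> p * \<psi> (T (s (Suc k) b))" for b
        by (subst T) (simp add: add mult const s_def)
      then have "(\<Sum>b<e. \<psi> (T (s k b)) * \<psi> (U b)) =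
          (\<Sum>b<e. fls_const (C ((Y ^^ k) y) b) * \<psi> (U b)) + \<psi> p * (\<Sum>b<e. \<psi> (T (s (Suc k) b)) * \<psi> (U b))"
        by (simp add: algebra_simps sum.distrib sum_distrib_left)
      then show ?thesis
        using eq[OF Yk[of k]] by (simp add: y'_def algebra_simps)
    qed
    have "Fin 0 \<le> fls_val (y' k)" for k
    proof -
      have "Fin 0 \<le> fls_val ((Y ^^ k) y)"
        by (rule order.trans[OF _ Yk]) (simp add: \<open>N \<ge> 0\<close>)
      then show ?thesis
        unfolding y'_def
        by (intro fls_val_diff fls_val_sum) (simp_all add: val_ge_0 flip: mult)
    qed
    moreover have "y' 0 = \<psi> p ^ k * y' k" for k
    proof (induction k)
      case (Suc k)
      then show ?case by (metis rec power_Suc2 mult.assoc)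
    qed simp
    moreover have "Fin (int k) \<le> fls_val (\<psi> p ^ k)" for k
      using x e \<open>N \<ge> 0\<close> mult_left_mono[of 1 "N + 1" "int k"]
      by (subst fls_val_power) (auto simp: fls_val_def split: if_splits)
    ultimately have "Fin (int k + 0) \<le> fls_val (y' 0)" for k
      by (metis fls_val_mult_ge)
    then have "y' 0 = 0" by (rule fls_eq_0_if_fls_val_ge)
    then have "y = \<psi> (\<Sum>b<e. T (s 0 b) * U b)"
      by (simp add: y'_def sum mult)
    then show "y \<in> range \<psi>" by blast
  qed
qed

end

lemma branch_if_branch_param: "branch_param P \<psi> \<Longrightarrow> branch \<psi>"
  unfolding branch_param_def by unfold_locales auto

section \<open>Values of tuples\<close>

lemma scal_apply [simp]: "scal c f i = fls_const c * f i"
  by (simp add: scal_def)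

lemma scal_1 [simp]: "scal 1 f = f"
  by (simp add: fun_eq_iff)

lemma sum_fun_apply: "(\<Sum>a\<in>A. F a) i = (\<Sum>a\<in>A. F a i :: 'b::comm_monoid_add)"
  by (induction A rule: infinite_finite_induct) auto

lemma scal_scal [simp]: "scal a (scal b f) = scal (a * b) f"
  by (simp add: fun_eq_iff mult.assoc flip: fls_const_mult_const)

lemma scal_sum: "scal a (\<Sum>x\<in>A. F x) = (\<Sum>x\<in>A. scal a (F x))"
  by (simp add: fun_eq_iff sum_fun_apply sum_distrib_left)

lemma scal_diff: "scal a (f - g) = scal a f - scal a g"
  by (simp add: fun_eq_iff algebra_simps)

lemma val_add: "a \<le> val i f \<Longrightarrow> a \<le> val i g \<Longrightarrow> a \<le> val i (f + g :: ('k::field, 'r) total)"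
  by (simp add: val_eq_fls_val fls_val_add)

lemma val_diff: "a \<le> val i f \<Longrightarrow> a \<le> val i g \<Longrightarrow> a \<le> val i (f - g :: ('k::field, 'r) total)"
  by (simp add: val_eq_fls_val fls_val_diff)

lemma val_sum: "(\<And>x. x \<in> A \<Longrightarrow> a \<le> val i (F x)) \<Longrightarrow> a \<le> val i (\<Sum>x\<in>A. F x :: ('k::field, 'r) total)"
  by (simp add: val_eq_fls_val sum_fun_apply fls_val_sum)

lemma val_mult_ge: "Fin a \<le> val i f \<Longrightarrow> Fin b \<le> val i g \<Longrightarrow> Fin (a + b) \<le> val i (f * g :: ('k::field, 'r) total)"
  by (simp add: val_eq_fls_val fls_val_mult_ge)

lemma val_scal [simp]: "c \<noteq> 0 \<Longrightarrow> val i (scal c f) = val i f"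
  by (simp add: val_eq_fls_val)

lemma val_scal_ge: "a \<le> val i f \<Longrightarrow> a \<le> val i (scal c f)"
  by (simp add: val_eq_fls_val fls_val_const_mult_ge)

lemma val_eq_Pinf_iff: "val i f = Pinf \<longleftrightarrow> f i = 0"
  by (simp add: val_eq_fls_val)

lemma val_zero [simp]: "val i 0 = Pinf"
  by (simp add: val_eq_Pinf_iff)

lemma val_neq_Minf [simp]: "val i f \<noteq> Minf" "Minf \<noteq> val i f"
  by (simp_all add: val_def)

lemma nonzero_obtain_val:
  assumes "f \<noteq> 0"
  obtains i n where "val i f = Fin n"
proof -
  obtain i where "f i \<noteq> 0" using assms by (auto simp: fun_eq_iff)
  then show ?thesis using that[of i] by (simp add: val_def)
qed

lemma val_eq_if_diff_large:
  fixes f g :: "('k::field, 'r) total"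
  assumes "val i f < val i (f - g)"
  shows "val i g = val i f"
proof -
  obtain n where n: "val i f = Fin n"
    using assms by (cases "val i f") auto
  have "Fin (n + 1) \<le> val i (f - g)"
    using assms n by (cases "val i (f - g)") auto
  then have "\<And>m. m \<le> n \<Longrightarrow> f i $$ m = g i $$ m"
    unfolding val_eq_fls_val fls_val_ge_iff by simp
  then have "val i g = Fin n"
    using n unfolding val_eq_fls_val fls_val_eq_Fin_iff by simp
  then show ?thesis using n by simp
qed

lemma lin_spanI:
  "f = (\<Sum>h\<in>S. a h * h) \<Longrightarrow> (\<And>h. h \<in> S \<Longrightarrow> a h \<in> A) \<Longrightarrow> f \<in> lin_span A S"
  unfolding lin_span_def by blast

section \<open>The local ring and its fractional ideals\<close>

text \<open>The distinctness of the branches enters as \<open>separated\<close>, which provides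
  elements supported on a single branch and so allows components to be prescribed
  independently.\<close>

locale curve =
  fixes \<phi> :: "'r::finite \<Rightarrow> ('k::field, 'n::finite) mps \<Rightarrow> 'k fls"
  assumes branch: "branch (\<phi> i)"
    and separated: "\<exists>z. \<phi> i z \<noteq> 0 \<and> (\<forall>j. j \<noteq> i \<longrightarrow> \<phi> j z = 0)"
begin

lemma emb_add: "emb \<phi> (p + q) = emb \<phi> p + emb \<phi> q"
  using branch.add[OF branch] by (simp add: emb_def fun_eq_iff)

lemma emb_mult: "emb \<phi> (p * q) = emb \<phi> p * emb \<phi> q"
  using branch.mult[OF branch] by (simp add: emb_def fun_eq_iff)

lemma emb_const: "emb \<phi> (mps_const c) = scal c 1"
  using branch.const[OF branch] by (simp add: emb_def fun_eq_iff)

lemma loc_ring_const: "scal c 1 \<in> loc_ring \<phi>"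
  unfolding loc_ring_def using emb_const by (metis rangeI)

lemma loc_ring_one: "1 \<in> loc_ring \<phi>"
  using loc_ring_const[of 1] by simp

lemma loc_ring_add: "a \<in> loc_ring \<phi> \<Longrightarrow> b \<in> loc_ring \<phi> \<Longrightarrow> a + b \<in> loc_ring \<phi>"
  by (auto simp: loc_ring_def simp flip: emb_add)

lemma loc_ring_mult: "a \<in> loc_ring \<phi> \<Longrightarrow> b \<in> loc_ring \<phi> \<Longrightarrow> a * b \<in> loc_ring \<phi>"
  by (auto simp: loc_ring_def simp flip: emb_mult)

lemma loc_ring_val: "a \<in> loc_ring \<phi> \<Longrightarrow> Fin 0 \<le> val i a"
  using branch.val_ge_0[OF branch] by (auto simp: loc_ring_def emb_def val_eq_fls_val)

lemma max_ideal_val: "a \<in> max_ideal \<phi> \<Longrightarrow> Fin 1 \<le> val i a"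
  using branch.val_ge_1[OF branch] by (auto simp: max_ideal_def emb_def val_eq_fls_val)

lemma max_ideal_subset: "max_ideal \<phi> \<subseteq> loc_ring \<phi>"
  by (auto simp: max_ideal_def loc_ring_def)

text \<open>As \<open>z i\<close> is supported on the branch \<open>i\<close>, the sum of the
  \<open>p i * z i\<close> has the component of \<open>p i * z i\<close> there. It suffices to lift
  the quotient of each component of \<open>f\<close> by that of \<open>z i\<close>; \<open>D\<close>
  exceeds each conductor by the order lost in this division.\<close>

lemma loc_ring_conductor:
  obtains N where "\<And>f. (\<And>i. Fin N \<le> val i f) \<Longrightarrow> f \<in> loc_ring \<phi>"
proof -
  obtain z where z: "\<And>i. \<phi> i (z i) \<noteq> 0" and z0: "\<And>i j. j \<noteq> i \<Longrightarrow> \<phi> j (z i) = 0"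
    using separated by metis
  have "\<exists>N. \<forall>x. Fin N \<le> fls_val x \<longrightarrow> x \<in> range (\<phi> i)" for i
    using branch.conductor_exists[OF branch] by metis
  then obtain N where N: "\<And>i x. Fin (N i) \<le> fls_val x \<Longrightarrow> x \<in> range (\<phi> i)" by metis
  define D where "D = (MAX i. N i + fls_subdegree (\<phi> i (z i)))"
  show ?thesis
  proof
    fix f :: "('k, 'r) total"
    assume f: "\<And>i. Fin D \<le> val i f"
    have "\<exists>p. f i / \<phi> i (z i) = \<phi> i p" for i
    proof -
      have "N i + fls_subdegree (\<phi> i (z i)) \<le> D" by (simp add: D_def)
      then have "Fin (N i) \<le> fls_val (f i / \<phi> i (z i))"
        using f[of i] z[of i] by (auto simp: val_def fls_val_def fls_divide_subdegree split: if_splits)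
      then show ?thesis using N by blast
    qed
    then obtain p where p: "\<And>i. f i / \<phi> i (z i) = \<phi> i (p i)" by metis
    have "emb \<phi> (\<Sum>i\<in>UNIV. p i * z i) = f"
    proof
      fix i
      have "emb \<phi> (\<Sum>i\<in>UNIV. p i * z i) i = (\<Sum>j\<in>UNIV. \<phi> i (p j) * \<phi> i (z j))"
        by (simp add: emb_def branch.sum[OF branch] branch.mult[OF branch])
      also have "\<dots> = (\<Sum>j\<in>{i}. \<phi> i (p j) * \<phi> i (z j))"
        by (rule sum.mono_neutral_right) (auto simp: z0)
      finally show "emb \<phi> (\<Sum>i\<in>UNIV. p i * z i) i = f i"
        using z[of i] by (simp flip: p)
    qed
    then show "f \<in> loc_ring \<phi>" unfolding loc_ring_def by blast
  qed
qed

lemma lin_span_add: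
  assumes "f \<in> lin_span (loc_ring \<phi>) S" "g \<in> lin_span (loc_ring \<phi>) S"
  shows "f + g \<in> lin_span (loc_ring \<phi>) S"
proof -
  obtain a b where "f = (\<Sum>h\<in>S. a h * h)" "g = (\<Sum>h\<in>S. b h * h)"
    and "\<forall>h\<in>S. a h \<in> loc_ring \<phi>" "\<forall>h\<in>S. b h \<in> loc_ring \<phi>"
    using assms unfolding lin_span_def by blast
  then have "f + g = (\<Sum>h\<in>S. (a h + b h) * h)" "\<And>h. h \<in> S \<Longrightarrow> a h + b h \<in> loc_ring \<phi>"
    by (auto simp: sum.distrib distrib_right loc_ring_add)
  then show ?thesis by (rule lin_spanI)
qed

lemma lin_span_mult:
  assumes "f \<in> lin_span (loc_ring \<phi>) S" "b \<in> loc_ring \<phi>"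
  shows "b * f \<in> lin_span (loc_ring \<phi>) S"
proof -
  obtain a where "f = (\<Sum>h\<in>S. a h * h)" "\<forall>h\<in>S. a h \<in> loc_ring \<phi>"
    using assms unfolding lin_span_def by blast
  then have "b * f = (\<Sum>h\<in>S. (b * a h) * h)" "\<And>h. h \<in> S \<Longrightarrow> b * a h \<in> loc_ring \<phi>"
    using assms by (auto simp: sum_distrib_left mult.assoc loc_ring_mult)
  then show ?thesis by (rule lin_spanI)
qed

end

text \<open>Distinct minimal primes are incomparable, so every other \<open>P j\<close> has an
  element outside \<open>P i\<close>. The product of these vanishes on all branches except
  \<open>i\<close>, where its image is a product of nonzero elements of a field.\<close>

lemma curve_if_algebroid_curve:
  assumes "algebroid_curve Q P \<phi>"
  shows "curve \<phi>"
proof (rule curve.intro)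
  have param: "branch_param (P i) (\<phi> i)" for i
    using assms unfolding algebroid_curve_def by blast
  show branch: "branch (\<phi> i)" for i
    by (rule branch_if_branch_param[OF param])
  have P: "P i = {p. \<phi> i p = 0}" for i
    using param[of i] unfolding branch_param_def by blast
  have minimal: "P i \<in> minimal_primes Q" and "inj P" for i
    using assms unfolding algebroid_curve_def by blast+
  fix i
  have "\<exists>p. \<phi> j p = 0 \<and> \<phi> i p \<noteq> 0" if "j \<noteq> i" for j
  proof -
    have "\<not> P j \<subseteq> P i"
    proof
      assume "P j \<subseteq> P i"
      moreover have "prime_ideal (P j)" "Q \<subseteq> P j"
        using minimal[of j] unfolding minimal_primes_def by blast+
      ultimately have "P j = P i"
        using minimal[of i] unfolding minimal_primes_def by blast
      then show False using \<open>inj P\<close> that by (auto dest: injD)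
    qed
    then show ?thesis unfolding P by blast
  qed
  then obtain p where p: "\<And>j. j \<noteq> i \<Longrightarrow> \<phi> j (p j) = 0 \<and> \<phi> i (p j) \<noteq> 0" by metis
  have prod: "\<phi> k (\<Prod>j\<in>A. p j) = (\<Prod>j\<in>A. \<phi> k (p j))" for k A
    by (induction A rule: infinite_finite_induct)
       (simp_all add: branch.one[OF branch] branch.mult[OF branch])
  show "\<exists>z. \<phi> i z \<noteq> 0 \<and> (\<forall>j. j \<noteq> i \<longrightarrow> \<phi> j z = 0)"
    by (rule exI[of _ "\<Prod>j\<in>UNIV - {i}. p j"]) (use p in \<open>auto simp: prod\<close>)
qed

locale curve_ideal = curve \<phi>
  for \<phi> :: "'r::finite \<Rightarrow> ('k::field, 'n::finite) mps \<Rightarrow> 'k fls" +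
  fixes J :: "('k, 'r) total set"
  assumes fractional: "fractional_ideal \<phi> J"
begin

lemma J_add: "f \<in> J \<Longrightarrow> g \<in> J \<Longrightarrow> f + g \<in> J"
  using fractional lin_span_add by (auto simp: fractional_ideal_def)

lemma J_mult: "b \<in> loc_ring \<phi> \<Longrightarrow> f \<in> J \<Longrightarrow> b * f \<in> J"
  using fractional lin_span_mult by (auto simp: fractional_ideal_def)

lemma J_scal: "f \<in> J \<Longrightarrow> scal c f \<in> J"
  using J_mult[OF loc_ring_const, of f c] by (simp add: scal_def times_fun_def)

lemma J_zero: "0 \<in> J"
  using fractional J_scal[of _ 0] by (fastforce simp: fractional_ideal_def scal_def zero_fun_def)

lemma J_diff: "f \<in> J \<Longrightarrow> g \<in> J \<Longrightarrow> f - g \<in> J"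
  using J_add[of f "scal (- 1) g"] J_scal[of g "- 1"]
  by (simp add: scal_def plus_fun_def fun_diff_def)

text \<open>A non zero divisor in \<open>J\<close> has no zero component, so a tuple of large values
  is its multiple by a tuple above the conductor of the local ring.\<close>

lemma J_conductor:
  obtains N where "\<And>f. (\<And>i. Fin N \<le> val i f) \<Longrightarrow> f \<in> J"
proof -
  obtain x where x: "x \<in> J" "\<And>y. x * y = 0 \<Longrightarrow> y = 0"
    using fractional unfolding fractional_ideal_def by blast
  have nz: "x i \<noteq> 0" for i
  proof
    assume "x i = 0"
    then have "x * (\<lambda>j. if j = i then 1 else 0) = 0" by (auto simp: fun_eq_iff)
    from x(2)[OF this] show False by (auto simp: fun_eq_iff split: if_splits)
  qed
  obtain N where N: "\<And>f. (\<And>i. Fin N \<le> val i f) \<Longrightarrow> f \<in> loc_ring \<phi>"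
    using loc_ring_conductor by blast
  define D where "D = (MAX i. N + fls_subdegree (x i))"
  show ?thesis
  proof
    fix f :: "('k, 'r) total" assume f: "\<And>i. Fin D \<le> val i f"
    have "Fin N \<le> val i (\<lambda>i. f i / x i)" for i
    proof -
      have "N + fls_subdegree (x i) \<le> D" by (simp add: D_def)
      then show ?thesis using f[of i] nz[of i]
        by (auto simp: val_def fls_divide_subdegree split: if_splits)
    qed
    then have "(\<lambda>i. f i / x i) * x \<in> J"
      by (intro J_mult N x)
    then show "f \<in> J" using nz by (simp add: times_fun_def)
  qed
qed

lemma J_lower_bound:
  obtains L where "\<And>f i. f \<in> J \<Longrightarrow> Fin L \<le> val i f"
proof -
  obtain S where S: "finite S" "J = lin_span (loc_ring \<phi>) S"
    using fractional unfolding fractional_ideal_def by blast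
  define L where "L = Min (insert 0 ((\<lambda>(h, i). fls_subdegree (h i)) ` (S \<times> UNIV)))"
  have "Fin L \<le> val i h" if "h \<in> S" for h i
    using that S(1) by (auto simp: val_def L_def intro!: Min_le)
  then have "Fin L \<le> val i (\<Sum>h\<in>S. a h * h)" if "\<forall>h\<in>S. a h \<in> loc_ring \<phi>" for a i
    using that val_mult_ge[of 0] loc_ring_val by (intro val_sum) fastforce
  then show ?thesis using that S(2) unfolding lin_span_def by blast
qed

text \<open>\<open>conductor\<close> is a definite description, so existence and uniqueness have to
  be shown. All integers from \<open>N\<close> on are values and none below \<open>L\<close> is, so
  there is a least start of an unbroken tail of values. Of two candidates, the smaller has the
  predecessor of the larger in its tail, a contradiction.\<close>

lemma kappa_values:
  assumes "kappa J i \<le> n"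
  shows "\<exists>f \<in> branch_part J i. val i f = Fin n"
proof -
  let ?V = "val i ` branch_part J i"
  let ?P = "\<lambda>c. (\<forall>m :: nat. Fin (c + int m) \<in> ?V) \<and> Pinf \<in> ?V \<and> Fin (c - 1) \<notin> ?V"
  obtain N where N: "\<And>f. (\<And>i. Fin N \<le> val i f) \<Longrightarrow> f \<in> J"
    using J_conductor by blast
  obtain L where L: "\<And>f i. f \<in> J \<Longrightarrow> Fin L \<le> val i f"
    using J_lower_bound by blast
  have above: "Fin n \<in> ?V" if "N \<le> n" for n
  proof -
    let ?e = "(\<lambda>j. if j = i then fls_X_intpow n else 0) :: ('k, 'r) total"
    have "?e \<in> branch_part J i"
      using that by (auto simp: branch_part_def val_def intro!: N)
    moreover have "val i ?e = Fin n" by (simp add: val_def)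
    ultimately show ?thesis by (metis image_eqI)
  qed
  have below: "Fin n \<notin> ?V" if "n < L" for n
  proof
    assume "Fin n \<in> ?V"
    then obtain f where "f \<in> J" "val i f = Fin n" by (auto simp: branch_part_def)
    then show False using L[of f i] that by simp
  qed
  have "L \<le> N" using above[of N] below[of N] by fastforce
  define d where "d = (LEAST d :: nat. \<forall>m :: nat. Fin (L + int d + int m) \<in> ?V)"
  have d: "\<forall>m :: nat. Fin (L + int d + int m) \<in> ?V"
    unfolding d_def
    by (rule LeastI[of _ "nat (N - L)"]) (use above \<open>L \<le> N\<close> in auto)
  have "Fin (L + int d - 1) \<notin> ?V"
  proof (cases d)
    case 0
    then show ?thesis by (simp add: below)
  next
    case (Suc d')
    have "\<not> (\<forall>m :: nat. Fin (L + int d' + int m) \<in> ?V)"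
      using not_less_Least[of d' "\<lambda>d. \<forall>m :: nat. Fin (L + int d + int m) \<in> ?V"] Suc
      unfolding d_def by simp
    then obtain m where m: "Fin (L + int d' + int m) \<notin> ?V" by blast
    \<comment> \<open>The tail from \<open>d\<close> on is complete, so the gap in the tail from
      \<open>d'\<close> can only be its first element.\<close>
    have "m = 0"
    proof (rule ccontr)
      assume "m \<noteq> 0"
      then have "L + int d' + int m = L + int d + int (m - 1)" by (simp add: Suc)
      then show False using d m by metis
    qed
    then show ?thesis using m by (simp add: Suc)
  qed
  moreover have "Pinf \<in> ?V"
    by (rule image_eqI[of _ _ 0]) (simp_all add: branch_part_def J_zero)
  ultimately have "?P (L + int d)" using d by blast
  moreover have "c = c'" if "?P c" "?P c'" for c c'
  proof -
    have False if "?P c" "?P c'" "c < c'" for c c'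
    proof -
      have "c' - 1 = c + int (nat (c' - 1 - c))" using that by simp
      then show False using that by metis
    qed
    then show ?thesis using that by (metis linorder_neqE_linordered_idom)
  qed
  ultimately have "\<exists>!c. ?P c" by blast
  then have "?P (kappa J i)"
    unfolding kappa_def conductor_def by (rule theI')
  moreover have "n = kappa J i + int (nat (n - kappa J i))" using assms by simp
  ultimately have "Fin n \<in> ?V" by metis
  then show ?thesis by auto
qed

end

section \<open>Limits\<close>

text \<open>The limit in the product topology in terms of values, with one index serving all of the
  finitely many branches.\<close>

definition approaches :: "(nat \<Rightarrow> ('k::field, 'r::finite) total) \<Rightarrow> ('k, 'r) total \<Rightarrow> bool" where
  "approaches F f \<longleftrightarrow> (\<forall>n. \<forall>\<^sub>F j in sequentially. \<forall>i. Fin n \<le> val i (f - F j))"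

lemma approaches_iff: "approaches F f \<longleftrightarrow> (\<forall>i. (\<lambda>j. F j i) \<longlonglongrightarrow> f i)"
proof -
  have "(\<lambda>j. F j i) \<longlonglongrightarrow> f i \<longleftrightarrow> (\<forall>n. \<forall>\<^sub>F j in sequentially. Fin n \<le> val i (f - F j))" for i
    by (simp add: fls_tendsto_iff eventually_sequentially val_eq_fls_val)
  then show ?thesis
    unfolding approaches_def
    using eventually_all_finite[of "\<lambda>j i. Fin _ \<le> val i (f - F j)" sequentially]
    by (blast intro: eventually_mono)
qed

text \<open>By the ultrametric inequality small consecutive differences suffice: each coefficient is
  eventually constant, and the stable coefficients form the limit.\<close>

lemma fls_Cauchy_limit:
  fixes X :: "nat \<Rightarrow> 'k::group_add fls"
  assumes steps: "\<And>n. \<exists>J. \<forall>j\<ge>J. Fin n \<le> fls_val (X (Suc j) - X j)"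
  shows "\<exists>L. X \<longlonglongrightarrow> L"
proof -
  obtain J where J: "\<And>n j. j \<ge> J n \<Longrightarrow> Fin n \<le> fls_val (X (Suc j) - X j)"
    using steps by metis
  have stable: "X j $$ m = X (J n) $$ m" if "j \<ge> J n" "m < n" for j m n
    using that(1)
  proof (induction j rule: dec_induct)
    case (step j)
    then show ?case using J[of n j] that(2) unfolding fls_val_ge_iff by simp
  qed simp
  have agree: "X (J n) $$ m = X (J n') $$ m" if "m < n" "m < n'" for m n n'
    using stable[of n "max (J n) (J n')" m] stable[of n' "max (J n) (J n')" m] that by simp
  define L where "L = Abs_fls (\<lambda>n. X (J (n + 1)) $$ n)"
  have L: "L $$ m = X (J (m + 1)) $$ m" for m
    unfolding L_def
  proof (rule nth_Abs_fls_lower_bound)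
    \<comment> \<open>In negative degrees the stable coefficients are those of the single series
      \<open>X (J 0)\<close>, so only finitely many are nonzero.\<close>
    show "\<forall>k<min 0 (fls_subdegree (X (J 0))). X (J (k + 1)) $$ k = 0"
    proof (intro allI impI)
      fix k assume k: "k < min 0 (fls_subdegree (X (J 0)))"
      then have "X (J (k + 1)) $$ k = X (J 0) $$ k" by (intro agree) auto
      then show "X (J (k + 1)) $$ k = 0" using k by simp
    qed
  qed
  have "Fin n \<le> fls_val (L - X j)" if "j \<ge> J n" for n j
    unfolding fls_val_ge_iff
  proof (intro allI impI)
    fix m assume "m < n"
    then have "X j $$ m = L $$ m"
      using stable[OF that] agree[of m n "m + 1"] by (simp add: L)
    then show "(L - X j) $$ m = 0" by simp
  qed
  then have "X \<longlonglongrightarrow> L" unfolding fls_tendsto_iff by blast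
  then show ?thesis ..
qed

lemma approaches_exists:
  assumes "\<And>n. \<forall>\<^sub>F j in sequentially. \<forall>i. Fin n \<le> val i (F (Suc j) - F j)"
  shows "\<exists>f. approaches F f"
proof -
  have "\<exists>L. (\<lambda>j. F j i) \<longlonglongrightarrow> L" for i
    using assms by (intro fls_Cauchy_limit) (simp add: eventually_sequentially val_eq_fls_val, blast)
  then show ?thesis unfolding approaches_iff by metis
qed

section \<open>Reductions\<close>

definition terms :: "('k::field, 'r) total set \<Rightarrow> ('k, 'r) total set \<Rightarrow> ('k, 'r) total set" where
  "terms G H = {gprod G \<alpha> * h | \<alpha> h. h \<in> H}"

text \<open>Because of the existential over branches, all but finitely many elements have value at
  least \<open>n\<close> on every branch at once, as convergence requires.\<close>

definition locally_finite :: "('k::field, 'r) total set \<Rightarrow> bool" where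
  "locally_finite M \<longleftrightarrow> (\<forall>n. finite {m \<in> M. \<exists>i. val i m < Fin n})"

lemma gprod_zero [simp]: "gprod G (\<lambda>_. 0) = 1"
  by (simp add: gprod_def)

lemma terms_self: "h \<in> H \<Longrightarrow> h \<in> terms G H"
  unfolding terms_def by (intro CollectI exI[of _ "\<lambda>_. 0"] exI[of _ h]) simp

lemma val_gprod_ge:
  assumes "\<And>g. g \<in> G \<Longrightarrow> Fin 1 \<le> val i g"
  shows "Fin (int (\<Sum>g\<in>G. \<alpha> g)) \<le> val i (gprod G \<alpha>)"
  using assms unfolding gprod_def
proof (induction G rule: infinite_finite_induct)
  case (insert g G)
  have "Fin (int n) \<le> val i (g ^ n)" for n
  proof (induction n)
    case (Suc n)
    show ?case using val_mult_ge[OF insert.prems[of g] Suc] by (simp only: power_Suc of_nat_Suc insertI1)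
  qed (simp add: val_def)
  moreover have "Fin (int (\<Sum>g\<in>G. \<alpha> g)) \<le> val i (\<Prod>g\<in>G. g ^ \<alpha> g)"
    using insert by blast
  ultimately show ?case
    unfolding prod.insert[OF insert.hyps(1,2)] sum.insert[OF insert.hyps(1,2)] of_nat_add
    by (rule val_mult_ge)
qed (simp_all add: val_def)

text \<open>Elements of \<open>G\<close> have value at least 1 on every branch, so a value below
  \<open>n\<close> on any branch bounds the sum of the exponents.\<close>

lemma locally_finite_terms:
  fixes G H :: "('k::field, 'r::finite) total set"
  assumes G: "finite G" "\<And>g i. g \<in> G \<Longrightarrow> Fin 1 \<le> val i g" and H: "finite H"
  shows "locally_finite (terms G H)"
  unfolding locally_finite_def
proof
  fix n :: int
  define L where "L = Min (insert 0 ((\<lambda>(h, i). fls_subdegree (h i)) ` (H \<times> UNIV)))"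
  have L: "Fin L \<le> val i h" if "h \<in> H" for h i
    using that H by (auto simp: val_def L_def intro!: Min_le)
  define E where "E = {\<alpha> :: ('k, 'r) total \<Rightarrow> nat. \<forall>g. (g \<in> G \<longrightarrow> \<alpha> g \<in> {..nat (n - L)}) \<and> (g \<notin> G \<longrightarrow> \<alpha> g = 0)}"
  have "finite E" unfolding E_def by (rule finite_set_of_finite_funs) (simp_all add: G)
  have "{m \<in> terms G H. \<exists>i. val i m < Fin n} \<subseteq> (\<lambda>(\<alpha>, h). gprod G \<alpha> * h) ` (E \<times> H)"
  proof clarify
    fix m i assume "m \<in> terms G H" and less: "val i m < Fin n"
    then obtain \<alpha> h where m: "m = gprod G \<alpha> * h" and h: "h \<in> H" by (auto simp: terms_def)
    \<comment> \<open>Exponents outside \<open>G\<close> do not affect the product; setting them to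
      0 leaves finitely many exponent functions.\<close>
    define \<beta> where "\<beta> g = (if g \<in> G then \<alpha> g else 0)" for g
    have "Fin (int (\<Sum>g\<in>G. \<alpha> g) + L) \<le> val i m"
      unfolding m by (intro val_mult_ge val_gprod_ge G L h)
    from order.strict_trans1[OF this less] have "int (\<Sum>g\<in>G. \<alpha> g) < n - L" by simp
    then have "(\<Sum>g\<in>G. \<alpha> g) \<le> nat (n - L)" by linarith
    then have "\<alpha> g \<le> nat (n - L)" if "g \<in> G" for g
      using member_le_sum[of g G \<alpha>] that G by simp
    then have "\<beta> \<in> E" by (simp add: E_def \<beta>_def)
    moreover have "m = gprod G \<beta> * h" by (simp add: m gprod_def \<beta>_def)
    ultimately show "m \<in> (\<lambda>(\<alpha>, h). gprod G \<alpha> * h) ` (E \<times> H)" using h by auto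
  qed
  then show "finite {m \<in> terms G H. \<exists>i. val i m < Fin n}"
    by (rule finite_subset) (use \<open>finite E\<close> H in blast)
qed

text \<open>Reducibility is a matter of values alone, since the coefficient can be chosen to cancel
  the leading terms.\<close>

definition reducer :: "'r \<Rightarrow> ('k::field, 'r) total set \<Rightarrow> ('k, 'r) total \<Rightarrow> ('k, 'r) total \<Rightarrow> bool" where
  "reducer k M f m \<longleftrightarrow> m \<in> M \<and> val k f \<noteq> Pinf \<and> val k m = val k f \<and> (\<forall>i. val i f \<le> val i m)"

lemma k_reduction_if_reducer:
  assumes "reducer k (terms G H) f m"
  obtains c where "k_reduction k H G f (f - scal c m)"
proof -
  obtain n where n: "val k f = Fin n" "val k m = Fin n"
    using assms by (cases "val k f") (auto simp: reducer_def)
  define c where "c = f k $$ n / m k $$ n"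
  have "val k f < val k (f - scal c m)"
    using fls_val_cancel[of "f k" n "m k"] n by (simp add: c_def val_eq_fls_val)
  moreover have "val i f \<le> val i (f - scal c m)" for i
    using assms by (intro val_diff val_scal_ge) (auto simp: reducer_def)
  ultimately have "k_reduction k H G f (f - scal c m)"
    using assms n unfolding k_reduction_def
    by (auto simp: reducer_def terms_def intro!: exI[of _ c])
  then show ?thesis by (rule that)
qed

lemma k_reductionE:
  assumes "k_reduction k H G f f'"
  obtains c m where "c \<noteq> 0" "f' = f - scal c m" "reducer k (terms G H) f m"
    "val k f < val k f'" "\<And>i. val i f \<le> val i f'"
proof -
  obtain c m where m: "f' = f - scal c m" "m \<in> terms G H"
    and val: "val k f \<noteq> Pinf" "val k f < val k f'" "\<And>i. val i f \<le> val i f'"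
    using assms unfolding k_reduction_def terms_def by blast
  have "c \<noteq> 0" using m val by (auto simp: scal_def fun_diff_def)
  have eq: "scal c m = f - f'" using m by simp
  have "val i f \<le> val i m" for i
    using val_diff[OF order.refl val(3)[of i]] \<open>c \<noteq> 0\<close> unfolding eq[symmetric] by simp
  moreover have "val k (scal c m) = val k f"
    using val(2) by (intro val_eq_if_diff_large) (simp add: m)
  ultimately show ?thesis
    using that[OF \<open>c \<noteq> 0\<close> m(1)] m val \<open>c \<noteq> 0\<close> by (simp add: reducer_def)
qed

lemma reduction_exists_iff: "(\<exists>f'. reduction H G f f') \<longleftrightarrow> (\<exists>k m. reducer k (terms G H) f m)"
  unfolding reduction_def by (meson k_reductionE k_reduction_if_reducer)

lemma reduction_val_mono: "reduction H G f f' \<Longrightarrow> val i f \<le> val i f'"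
  by (auto simp: reduction_def k_reduction_def)

lemma reductions_val_mono: "(reduction H G)\<^sup>*\<^sup>* f f' \<Longrightarrow> val i f \<le> val i f'"
  by (induction rule: rtranclp_induct) (auto intro: order.trans reduction_val_mono)

text \<open>Where the limit vanishes, the values of \<open>F j\<close> may stay finite and merely
  tend to infinity; hence the exception.\<close>

lemma approaches_val:
  assumes "approaches F f"
  shows "\<forall>\<^sub>F j in sequentially. \<forall>i. val i f \<noteq> Pinf \<longrightarrow> val i (F j) = val i f"
proof (rule eventually_all_finite)
  fix i
  show "\<forall>\<^sub>F j in sequentially. val i f \<noteq> Pinf \<longrightarrow> val i (F j) = val i f"
  proof (cases "val i f")
    case (Fin n)
    have "\<forall>\<^sub>F j in sequentially. \<forall>i. Fin (n + 1) \<le> val i (f - F j)"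
      using assms unfolding approaches_def by blast
    then show ?thesis
    proof eventually_elim
      case (elim j)
      then have "Fin (n + 1) \<le> val i (f - F j)" by blast
      then have "val i f < val i (f - F j)"
        using less_le_trans[of "Fin n" "Fin (n + 1)"] by (simp add: Fin)
      then show ?case by (intro impI val_eq_if_diff_large)
    qed
  qed auto
qed

text \<open>A finite sequence of reductions is continued by the constant sequence.\<close>

lemma final_reductionE:
  fixes f f' :: "('k::field, 'r::finite) total"
  assumes "final_reduction H G f f'"
  obtains F where "approaches F f'" "\<And>j. (reduction H G)\<^sup>*\<^sup>* f (F j)"
  using assms unfolding final_reduction_def
proof (elim conjE disjE exE)
  assume "(reduction H G)\<^sup>*\<^sup>* f f'"
  then show ?thesis by (intro that[of "\<lambda>_. f'"]) (simp_all add: approaches_iff)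
next
  fix F assume F0: "F 0 = f" and F: "\<forall>j. reduction H G (F j) (F (Suc j))"
    and "\<forall>i. (\<lambda>j. F j i) \<longlonglongrightarrow> f' i"
  moreover have "(reduction H G)\<^sup>*\<^sup>* f (F j)" for j
    by (induction j) (use F0 F in \<open>auto intro: rtranclp.rtrancl_into_rtrancl\<close>)
  ultimately show ?thesis by (intro that) (simp_all add: approaches_iff)
qed

lemma final_reduction_val_mono:
  fixes f f' :: "('k::field, 'r::finite) total"
  assumes "final_reduction H G f f'"
  shows "val i f \<le> val i f'"
proof (cases "val i f' = Pinf")
  case False
  obtain F where F: "approaches F f'" "\<And>j. (reduction H G)\<^sup>*\<^sup>* f (F j)"
    using assms by (rule final_reductionE) blast
  obtain j where "val i (F j) = val i f'"
    using approaches_val[OF F(1)] False unfolding eventually_sequentially by blast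
  then show ?thesis using reductions_val_mono[OF F(2)] by metis
qed simp

text \<open>Every step uses up the pair of its term and its branch, so in an infinite sequence of reductions
  the terms have values tending to infinity on all branches, and the sequence converges. If
  moreover always the first applicable term of a fixed enumeration is chosen, then a term reducing
  the limit would reduce almost all members of the sequence, which forces infinitely many
  steps to use the finitely many terms up to it.\<close>

lemma final_reduction_exists:
  fixes G H :: "('k::field, 'r::finite) total set"
  assumes lf: "locally_finite (terms G H)" and f: "f \<noteq> 0"
  shows "\<exists>f'. final_reduction H G f f'"
proof (cases "\<exists>f'. (reduction H G)\<^sup>*\<^sup>* f f' \<and> \<not> (\<exists>f''. reduction H G f' f'')")
  case True
  then show ?thesis using f by (auto simp: final_reduction_def)
next
  case False
  define M where "M = terms G H"
  \<comment> \<open>This rank plays the part of the enumeration: by local finiteness only finitely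
    many nonzero terms have rank at most \<open>n\<close>. Elements with a negative value have rank
    0.\<close>
  define \<mu> where "\<mu> m = (LEAST n. \<exists>i. val i m < Fin (int n))" for m :: "('k, 'r) total"
  have \<mu>: "\<exists>i. val i m < Fin (int (\<mu> m))" if "m \<noteq> 0" for m
  proof -
    obtain i n where "val i m = Fin n" using nonzero_obtain_val[OF \<open>m \<noteq> 0\<close>] by blast
    then have "\<exists>i. val i m < Fin (int (nat (n + 1)))" by (intro exI[of _ i]) simp
    then show ?thesis unfolding \<mu>_def by (rule LeastI)
  qed
  have fin_\<mu>: "finite {m \<in> M. m \<noteq> 0 \<and> \<mu> m \<le> n}" for n
  proof (rule finite_subset)
    show "{m \<in> M. m \<noteq> 0 \<and> \<mu> m \<le> n} \<subseteq> {m \<in> M. \<exists>i. val i m < Fin (int n)}"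
    proof clarify
      fix m assume "m \<noteq> 0" "\<mu> m \<le> n"
      then obtain i where "val i m < Fin (int (\<mu> m))" "Fin (int (\<mu> m)) \<le> Fin (int n)"
        using \<mu> by auto
      then show "\<exists>i. val i m < Fin (int n)" by (meson less_le_trans)
    qed
    show "finite {m \<in> M. \<exists>i. val i m < Fin (int n)}"
      using lf by (simp add: locally_finite_def M_def)
  qed
  define step where "step g g' \<longleftrightarrow> (\<exists>k m c. reducer k M g m \<and> g' = g - scal c m \<and> k_reduction k H G g g' \<and>
      (\<forall>k' m'. reducer k' M g m' \<longrightarrow> \<mu> m \<le> \<mu> m'))" for g g'
  have step_exists: "\<exists>g'. step g g'" if "(reduction H G)\<^sup>*\<^sup>* f g" for g
  proof -
    have "\<exists>m. \<exists>k. reducer k M g m"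
      using False that reduction_exists_iff[of H G g] unfolding M_def by blast
    then obtain m where m: "\<exists>k. reducer k M g m" "\<And>m' k'. reducer k' M g m' \<Longrightarrow> \<mu> m \<le> \<mu> m'"
      using ex_has_least_nat[of "\<lambda>m. \<exists>k. reducer k M g m" _ \<mu>] by blast
    then obtain k where k: "reducer k M g m" by blast
    then obtain c where "k_reduction k H G g (g - scal c m)"
      unfolding M_def by (rule k_reduction_if_reducer)
    then show ?thesis using k m(2) unfolding step_def by blast
  qed
  have "\<exists>F. F 0 = f \<and> (\<forall>j. (reduction H G)\<^sup>*\<^sup>* f (F j)) \<and> (\<forall>j. step (F j) (F (Suc j)))"
  proof -
    have "\<exists>F. \<forall>j. ((reduction H G)\<^sup>*\<^sup>* f (F j) \<and> (j = 0 \<longrightarrow> F j = f)) \<and> step (F j) (F (Suc j))"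
    proof (rule dependent_nat_choice)
      fix g and j :: nat
      assume g: "(reduction H G)\<^sup>*\<^sup>* f g \<and> (j = 0 \<longrightarrow> g = f)"
      then obtain g' where "step g g'" using step_exists by blast
      moreover from this have "reduction H G g g'" unfolding step_def reduction_def by blast
      ultimately show "\<exists>g'. ((reduction H G)\<^sup>*\<^sup>* f g' \<and> (Suc j = 0 \<longrightarrow> g' = f)) \<and> step g g'"
        using g by (auto intro: rtranclp.rtrancl_into_rtrancl)
    qed auto
    then show ?thesis by blast
  qed
  then obtain F where F0: "F 0 = f" and F: "\<And>j. step (F j) (F (Suc j))" by blast
  obtain k m c where m: "\<And>j. reducer (k j) M (F j) (m j)" and eq: "\<And>j. F (Suc j) = F j - scal (c j) (m j)"
    and red: "\<And>j. k_reduction (k j) H G (F j) (F (Suc j))"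
    and least: "\<And>j k' m'. reducer k' M (F j) m' \<Longrightarrow> \<mu> (m j) \<le> \<mu> m'"
    using F unfolding step_def by metis
  have nz: "m j \<noteq> 0" for j using m[of j] by (auto simp: reducer_def)
  have mono: "val i (F j) \<le> val i (F j')" if "j \<le> j'" for i j j'
    by (rule lift_Suc_mono_le[OF _ that]) (use red in \<open>auto simp: k_reduction_def\<close>)
  \<comment> \<open>After step \<open>j\<close> the value on the branch \<open>k j\<close> has
    passed that of \<open>m j\<close> and never falls back.\<close>
  have "inj (\<lambda>j. (m j, k j))"
  proof (rule linorder_injI)
    fix j j' :: nat assume "j < j'"
    show "(m j, k j) \<noteq> (m j', k j')"
    proof
      assume "(m j, k j) = (m j', k j')"
      then have "val (k j) (F j) = val (k j) (F j')"
        using m[of j] m[of j'] by (simp add: reducer_def)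
      moreover have "val (k j) (F j) < val (k j) (F (Suc j))" using red[of j] by (simp add: k_reduction_def)
      moreover have "\<dots> \<le> val (k j) (F j')" using \<open>j < j'\<close> by (intro mono) simp
      ultimately show False by simp
    qed
  qed
  have fin: "\<forall>\<^sub>F j in sequentially. m j \<notin> A" if "finite A" for A
  proof -
    have "finite ((\<lambda>j. (m j, k j)) -` (A \<times> UNIV))"
      using that \<open>inj (\<lambda>j. (m j, k j))\<close> by (intro finite_vimageI) auto
    moreover have "(\<lambda>j. (m j, k j)) -` (A \<times> UNIV) = {j. \<not> m j \<notin> A}" by auto
    ultimately show ?thesis
      by (simp add: cofinite_eq_sequentially[symmetric] eventually_cofinite)
  qed
  have "\<exists>f'. approaches F f'"
  proof (rule approaches_exists)
    fix n
    have "\<forall>\<^sub>F j in sequentially. m j \<notin> {m \<in> M. \<exists>i. val i m < Fin n}"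
      using lf by (intro fin) (simp add: locally_finite_def M_def)
    then show "\<forall>\<^sub>F j in sequentially. \<forall>i. Fin n \<le> val i (F (Suc j) - F j)"
    proof eventually_elim
      case (elim j)
      have "Fin n \<le> val i (0 - scal (c j) (m j))" for i
        using elim m[of j] by (intro val_diff val_scal_ge) (auto simp: reducer_def not_less)
      then show ?case by (simp add: eq)
    qed
  qed
  then obtain f' where f': "approaches F f'" ..
  have "\<not> (\<exists>f''. reduction H G f' f'')"
  proof
    assume "\<exists>f''. reduction H G f' f''"
    then obtain k' m' where m': "reducer k' M f' m'"
      unfolding reduction_exists_iff M_def by blast
    have "\<forall>\<^sub>F j in sequentially. \<mu> (m j) \<le> \<mu> m'"
      using approaches_val[OF f']
    proof eventually_elim
      case (elim j)
      \<comment> \<open>Where \<open>f'\<close> vanishes, so does its reducer \<open>m'\<close>;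
        elsewhere \<open>F j\<close> already has the value of \<open>f'\<close>.\<close>
      have "val i (F j) \<le> val i m'" for i
        using elim m' by (cases "val i f' = Pinf") (auto simp: reducer_def, metis Pinf_le le_Pinf)
      then have "reducer k' M (F j) m'" using elim m' by (auto simp: reducer_def)
      then show ?case by (rule least)
    qed
    moreover have "\<forall>\<^sub>F j in sequentially. m j \<notin> {m \<in> M. m \<noteq> 0 \<and> \<mu> m \<le> \<mu> m'}"
      by (rule fin[OF fin_\<mu>])
    ultimately have "\<forall>\<^sub>F j :: nat in sequentially. False"
      by eventually_elim (use m nz in \<open>auto simp: reducer_def\<close>)
    then show False by simp
  qed
  moreover have "\<forall>j. reduction H G (F j) (F (Suc j))" using red unfolding reduction_def by blast
  ultimately show ?thesis
    using f f' F0 unfolding final_reduction_def approaches_iff by blast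
qed

section \<open>Approximate representations\<close>

text \<open>\<open>v\<close> bounds the values of the terms from below. A finite sum with an error of
  large value replaces the convergent infinite sums of the informal theory.\<close>

definition approx ::
    "('k::field, 'r) total set \<Rightarrow> ('r \<Rightarrow> int extended) \<Rightarrow> int \<Rightarrow> ('k, 'r) total \<Rightarrow> bool" where
  "approx M v N f \<longleftrightarrow> (\<exists>A c. finite A \<and> A \<subseteq> {m \<in> M. \<forall>i. v i \<le> val i m} \<and>
     (\<forall>i. Fin N \<le> val i (f - (\<Sum>m\<in>A. scal (c m) m))))"

lemma approxE:
  assumes "approx M v N f"
  obtains A c e where "finite A" "A \<subseteq> M" "\<And>m i. m \<in> A \<Longrightarrow> v i \<le> val i m"
    "f = (\<Sum>m\<in>A. scal (c m) m) + e" "\<And>i. Fin N \<le> val i e"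
proof -
  obtain A c where "finite A" "A \<subseteq> {m \<in> M. \<forall>i. v i \<le> val i m}"
    and "\<And>i. Fin N \<le> val i (f - (\<Sum>m\<in>A. scal (c m) m))"
    using assms unfolding approx_def by blast
  then show ?thesis
    by (intro that[of A c "f - (\<Sum>m\<in>A. scal (c m) m)"]) auto
qed

lemma approx_error: "(\<And>i. Fin N \<le> val i f) \<Longrightarrow> approx M v N f"
  unfolding approx_def by (intro exI[of _ "{}"]) simp

lemma approx_term: "m \<in> M \<Longrightarrow> (\<And>i. v i \<le> val i m) \<Longrightarrow> approx M v N m"
  unfolding approx_def by (intro exI[of _ "{m}"] exI[of _ "\<lambda>_. 1"]) simp

lemma approx_mono:
  assumes "approx M v N f" "M \<subseteq> M'" "\<And>i. v' i \<le> v i"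
  shows "approx M' v' N f"
proof -
  have "{m \<in> M. \<forall>i. v i \<le> val i m} \<subseteq> {m \<in> M'. \<forall>i. v' i \<le> val i m}"
    using assms(2,3) by (auto intro: order.trans)
  then show ?thesis using assms(1) unfolding approx_def by (meson order.trans)
qed

lemma approx_add:
  assumes "approx M v N f" "approx M v N g"
  shows "approx M v N (f + g)"
proof -
  let ?M = "{m \<in> M. \<forall>i. v i \<le> val i m}"
  obtain A c where A: "finite A" "A \<subseteq> ?M" "\<And>i. Fin N \<le> val i (f - (\<Sum>m\<in>A. scal (c m) m))"
    using assms(1) unfolding approx_def by blast
  obtain B d where B: "finite B" "B \<subseteq> ?M" "\<And>i. Fin N \<le> val i (g - (\<Sum>m\<in>B. scal (d m) m))"
    using assms(2) unfolding approx_def by blast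
  define b where "b m = (if m \<in> A then c m else 0) + (if m \<in> B then d m else 0)" for m
  have split: "scal (b m) m = (if m \<in> A then scal (c m) m else 0) + (if m \<in> B then scal (d m) m else 0)" for m
    by (auto simp: b_def fun_eq_iff algebra_simps simp flip: fls_plus_const)
  have "(\<Sum>m\<in>A \<union> B. if m \<in> A then scal (c m) m else 0) = (\<Sum>m\<in>A. scal (c m) m)"
    using A(1) B(1) by (simp add: sum.If_cases Int_absorb1)
  moreover have "(\<Sum>m\<in>A \<union> B. if m \<in> B then scal (d m) m else 0) = (\<Sum>m\<in>B. scal (d m) m)"
    using A(1) B(1) by (simp add: sum.If_cases Int_absorb1)
  ultimately have "f + g - (\<Sum>m\<in>A \<union> B. scal (b m) m) =
      (f - (\<Sum>m\<in>A. scal (c m) m)) + (g - (\<Sum>m\<in>B. scal (d m) m))"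
    unfolding split sum.distrib by simp
  then have "Fin N \<le> val i (f + g - (\<Sum>m\<in>A \<union> B. scal (b m) m))" for i
    using val_add[OF A(3)[of i] B(3)[of i]] by metis
  then show ?thesis
    unfolding approx_def using A B by (intro exI[of _ "A \<union> B"] exI[of _ b]) auto
qed

lemma approx_scal:
  assumes "approx M v N f"
  shows "approx M v N (scal a f)"
proof -
  obtain A c where A: "finite A" "A \<subseteq> {m \<in> M. \<forall>i. v i \<le> val i m}"
    "\<And>i. Fin N \<le> val i (f - (\<Sum>m\<in>A. scal (c m) m))"
    using assms unfolding approx_def by blast
  have "scal a f - (\<Sum>m\<in>A. scal (a * c m) m) = scal a (f - (\<Sum>m\<in>A. scal (c m) m))"
    by (simp add: scal_diff scal_sum)
  then have "Fin N \<le> val i (scal a f - (\<Sum>m\<in>A. scal (a * c m) m))" for i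
    using val_scal_ge[OF A(3)] by simp
  then show ?thesis
    unfolding approx_def using A by (intro exI[of _ A] exI[of _ "\<lambda>m. a * c m"]) auto
qed

lemma approx_sum: "(\<And>x. x \<in> X \<Longrightarrow> approx M v N (F x)) \<Longrightarrow> approx M v N (\<Sum>x\<in>X. F x)"
  by (induction X rule: infinite_finite_induct) (auto intro: approx_add approx_error)

text \<open>Every subtracted term has at least the values of the current element, hence those of
  \<open>f\<close>. The sum is exact, so any \<open>N\<close> is allowed.\<close>

lemma approx_reductions:
  assumes "(reduction H G)\<^sup>*\<^sup>* f g"
  shows "approx (terms G H) (\<lambda>i. val i f) N (f - g)"
  using assms
proof (induction rule: rtranclp_induct)
  case (step g g')
  obtain c m k where g': "g' = g - scal c m" and m: "reducer k (terms G H) g m"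
    using step.hyps(2) unfolding reduction_def by (meson k_reductionE)
  have "approx (terms G H) (\<lambda>i. val i f) N m"
    using m reductions_val_mono[OF step.hyps(1)]
    by (intro approx_term) (auto simp: reducer_def intro: order.trans)
  then have "approx (terms G H) (\<lambda>i. val i f) N ((f - g) + scal c m)"
    by (intro approx_add approx_scal step.IH)
  moreover have "f - g' = (f - g) + scal c m" unfolding g' by (rule ext) simp
  ultimately show ?case by (simp only:)
qed (rule approx_error, simp add: val_def)

text \<open>The sequence is cut off once its remainder has values at least \<open>N\<close>; the
  terms used up to there form a finite sum.\<close>

lemma approx_final_reduction_zero:
  fixes f :: "('k::field, 'r::finite) total"
  assumes "final_reduction H G f 0"
  shows "approx (terms G H) (\<lambda>i. val i f) N f"
proof -
  obtain F where F: "approaches F 0" "\<And>j. (reduction H G)\<^sup>*\<^sup>* f (F j)"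
    using assms by (rule final_reductionE) blast
  obtain j where j: "\<And>i. Fin N \<le> val i (0 - F j)"
    using F(1) unfolding approaches_def eventually_sequentially by blast
  have "approx (terms G H) (\<lambda>i. val i f) N (F j)"
    using val_diff[of "Fin N" _ 0 "0 - F j"] j by (intro approx_error) simp
  then have "approx (terms G H) (\<lambda>i. val i f) N ((f - F j) + F j)"
    by (rule approx_add[OF approx_reductions[OF F(2)]])
  then show ?thesis by simp
qed

section \<open>The procedure\<close>

lemma scalar_representatives_exists:
  fixes F :: "('k::field, 'r) total set"
  shows "\<exists>S. scalar_representatives F S"
proof -
  define E where "E f s \<longleftrightarrow> (\<exists>c. c \<noteq> 0 \<and> f = scal c s)" for f s :: "('k, 'r) total"
  have refl: "E f f" for f
    unfolding E_def by (intro exI[of _ 1]) simp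
  have sym: "E g f" if fg: "E f g" for f g
  proof -
    obtain c where "c \<noteq> 0" "f = scal c g" using fg unfolding E_def by blast
    then show ?thesis unfolding E_def by (intro exI[of _ "inverse c"]) simp
  qed
  have trans: "E f h" if fgh: "E f g" "E g h" for f g h
  proof -
    obtain c d where "c \<noteq> 0" "d \<noteq> 0" "f = scal (c * d) h"
      using fgh unfolding E_def by auto
    then show ?thesis unfolding E_def by (intro exI[of _ "c * d"]) simp
  qed
  define rep where "rep f = (SOME s. s \<in> F \<and> E f s)" for f
  have rep: "rep f \<in> F \<and> E f (rep f)" if "f \<in> F" for f
    unfolding rep_def by (rule someI[of _ f]) (simp add: refl that)
  have eq: "rep f = rep g" if "E f g" for f g
  proof -
    have "E f s \<longleftrightarrow> E g s" for s using that sym trans by blast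
    then show ?thesis unfolding rep_def by simp
  qed
  have "\<exists>!s. s \<in> rep ` F \<and> E f s" if "f \<in> F" for f
  proof (rule ex1I[of _ "rep f"])
    fix s assume "s \<in> rep ` F \<and> E f s"
    then obtain g where "g \<in> F" "s = rep g" "E f s" by blast
    then have "E f g" using rep sym trans by blast
    then show "s = rep f" using eq[of f g] \<open>s = rep g\<close> by simp
  qed (use rep that in blast)
  then have "scalar_representatives F (rep ` F)"
    unfolding scalar_representatives_def E_def using rep by blast
  then show ?thesis ..
qed

text \<open>Representatives proportional to the same element of \<open>T\<close> are proportional to
  each other, hence equal.\<close>

lemma scalar_representatives_finite:
  fixes F :: "('k::field, 'r) total set"
  assumes S: "scalar_representatives F S" and "finite T"
    and T: "\<And>f. f \<in> F \<Longrightarrow> \<exists>t\<in>T. \<exists>c. c \<noteq> 0 \<and> f = scal c t"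
  shows "finite S"
proof -
  obtain t c where t: "\<And>f. f \<in> F \<Longrightarrow> t f \<in> T" and c: "\<And>f. f \<in> F \<Longrightarrow> c f \<noteq> 0 \<and> f = scal (c f) (t f)"
    using T by metis
  have "S \<subseteq> F" using S by (simp add: scalar_representatives_def)
  have "inj_on t S"
  proof (rule inj_onI)
    fix f g assume fg: "f \<in> S" "g \<in> S" "t f = t g"
    then have F: "f \<in> F" "g \<in> F" using \<open>S \<subseteq> F\<close> by auto
    have "f = scal (c f) (t g)" "t g = scal (inverse (c g)) g"
      using c[OF F(1)] c[OF F(2)] fg(3) by (simp, metis left_inverse scal_1 scal_scal)
    then have "f = scal (c f * inverse (c g)) g" by (metis scal_scal)
    moreover have "c f * inverse (c g) \<noteq> 0" using c F by simp
    moreover have "f = scal 1 f" "(1 :: 'k) \<noteq> 0" by simp_all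
    ultimately show "f = g" using S F fg unfolding scalar_representatives_def by metis
  qed
  moreover have "t ` S \<subseteq> T" using t \<open>S \<subseteq> F\<close> by blast
  ultimately show ?thesis using \<open>finite T\<close> by (meson finite_imageD finite_subset)
qed

text \<open>Carries smallness from one branch to all others: only finitely many elements have a
  value below \<open>n\<close>, and \<open>D\<close> exceeds all their finite values.\<close>

lemma locally_finite_bound:
  fixes M :: "('k::field, 'r::finite) total set"
  assumes "locally_finite M"
  obtains D where "\<And>m i j. m \<in> M \<Longrightarrow> val i m < Fin n \<Longrightarrow> val j m < Fin D \<or> val j m = Pinf"
proof -
  define A where "A = {m \<in> M. \<exists>i. val i m < Fin n}"
  have "finite A" using assms by (simp add: A_def locally_finite_def)
  define D where "D = Max (insert 0 ((\<lambda>(m, i). fls_subdegree (m i)) ` (A \<times> UNIV))) + 1"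
  have "val j m < Fin D \<or> val j m = Pinf" if "m \<in> A" for m j
  proof -
    have "fls_subdegree (m j) \<le> Max (insert 0 ((\<lambda>(m, i). fls_subdegree (m i)) ` (A \<times> UNIV)))"
      using \<open>finite A\<close> that by (intro Max_ge) auto
    then show ?thesis by (simp add: val_def D_def)
  qed
  then show ?thesis by (intro that) (auto simp: A_def)
qed

text \<open>A relevant S-process involves only terms from the finite set \<open>A\<close>. Up to a
  scalar it is either a single term or determined by \<open>k\<close> and its two terms, since the
  ratio of the coefficients is forced by the cancellation on \<open>k\<close>.\<close>

lemma relevant_s_processes_finite:
  fixes G H :: "('k::field, 'r::finite) total set"
  assumes lf: "locally_finite (terms G H)"
  obtains T where "finite T"
    "\<And>f. f \<in> relevant_s_processes H G \<rho> \<Longrightarrow> \<exists>t\<in>T. \<exists>c. c \<noteq> 0 \<and> f = scal c t"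
proof -
  define M where "M = terms G H"
  define R where "R = Max (range \<rho>)"
  have R: "\<rho> i \<le> R" for i by (simp add: R_def)
  obtain D where D: "\<And>m i j. m \<in> M \<Longrightarrow> val i m < Fin R \<Longrightarrow> val j m < Fin D \<or> val j m = Pinf"
    using locally_finite_bound[OF lf] unfolding M_def by blast
  define A where "A = {m \<in> M. \<exists>i. val i m < Fin (max R D)}"
  have "finite A" using lf by (simp add: A_def locally_finite_def M_def)
  define s where "s = (\<lambda>(k, m1, m2). let n = fls_subdegree (m1 k)
     in (m1 :: ('k, 'r) total) - scal (m1 k $$ n / m2 k $$ n) m2)"
  have low: "m \<in> A" if "m \<in> M" "val i m < Fin R" for m i
  proof -
    have "Fin R \<le> Fin (max R D)" by simp
    then show ?thesis unfolding A_def using that by (blast intro: less_le_trans)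
  qed
  show ?thesis
  proof
    show "finite (A \<union> s ` (UNIV \<times> A \<times> A))" using \<open>finite A\<close> by simp
    fix f assume "f \<in> relevant_s_processes H G \<rho>"
    then obtain k i c1 c2 m1 m2 where m: "m1 \<in> M" "m2 \<in> M" and f: "f = scal c1 m1 + scal c2 m2"
      and k: "min (val k m1) (val k m2) < val k f" and "val i f < Fin (\<rho> i)"
      unfolding relevant_s_processes_def s_process_def M_def terms_def by blast
    then have i: "val i f < Fin R" using R[of i] by (auto intro: less_le_trans)
    then have "f \<noteq> 0" by auto
    consider "c1 = 0" | "c2 = 0" | "c1 \<noteq> 0" "c2 \<noteq> 0" by blast
    then show "\<exists>t\<in>A \<union> s ` (UNIV \<times> A \<times> A). \<exists>c. c \<noteq> 0 \<and> f = scal c t"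
    proof cases
      case 1
      then have "f = scal c2 m2" by (simp add: f fun_eq_iff)
      moreover from this have "c2 \<noteq> 0" using \<open>f \<noteq> 0\<close> by (auto simp: fun_eq_iff)
      ultimately show ?thesis using low[OF m(2), of i] i by (auto intro!: exI[of _ c2])
    next
      case 2
      then have "f = scal c1 m1" by (simp add: f fun_eq_iff)
      moreover from this have "c1 \<noteq> 0" using \<open>f \<noteq> 0\<close> by (auto simp: fun_eq_iff)
      ultimately show ?thesis using low[OF m(1), of i] i by (auto intro!: exI[of _ c1])
    next
      case 3
      have "val k m1 = val k m2"
      proof (rule ccontr)
        assume "val k m1 \<noteq> val k m2"
        then consider "val k m1 < val k m2" | "val k m2 < val k m1" by fastforce
        then show False
        proof cases
          case 1
          have "val k (scal c1 m1 - f) = val k (scal c2 m2)"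
            using 3 by (simp add: f val_def)
          then have "val k f = val k (scal c1 m1)"
            using 1 3 by (intro val_eq_if_diff_large) simp
          then show False using k 1 3 by simp
        next
          case 2
          have "val k (scal c2 m2 - f) = val k (scal c1 m1)"
            using 3 by (simp add: f val_def)
          then have "val k f = val k (scal c2 m2)"
            using 2 3 by (intro val_eq_if_diff_large) simp
          then show False using k 2 3 by simp
        qed
      qed
      then obtain n where n: "val k m1 = Fin n" "val k m2 = Fin n" "Fin n < val k f"
        using k by (cases "val k m2") auto
      \<comment> \<open>A sum of value below \<open>R\<close> on \<open>i\<close> has a summand
        below \<open>R\<close> there. The bound \<open>D\<close> carries this over to
        \<open>k\<close>, where both terms have the value \<open>n\<close>, so both lie in
        \<open>A\<close>.\<close>
      have "val i m1 < Fin R \<or> val i m2 < Fin R"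
        using i val_add[of "Fin R" i "scal c1 m1" "scal c2 m2"] val_scal_ge[of "Fin R" i]
        unfolding f by (meson not_le)
      then have "n < D"
        using D[OF m(1), of i k] D[OF m(2), of i k] n by auto
      then have mA: "m1 \<in> A" "m2 \<in> A" using m n by (auto simp: A_def intro!: exI[of _ k])
      have lc: "m1 k $$ n \<noteq> 0" "m2 k $$ n \<noteq> 0" and deg: "fls_subdegree (m1 k) = n"
        using n unfolding val_eq_fls_val fls_val_eq_Fin_iff by (auto intro: fls_subdegree_eqI)
      have "Fin (n + 1) \<le> val k f" using n(3) by (cases "val k f") auto
      then have "f k $$ n = 0" unfolding val_eq_fls_val fls_val_ge_iff by simp
      then have "c1 * m1 k $$ n + c2 * m2 k $$ n = 0" by (simp add: f)
      then have "c2 = - (c1 * (m1 k $$ n / m2 k $$ n))"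
        using lc by (simp add: field_simps eq_neg_iff_add_eq_0)
      then have "scal c2 m2 = - scal (c1 * (m1 k $$ n / m2 k $$ n)) m2"
        by (simp add: fun_eq_iff)
      then have "f = scal c1 (s (k, m1, m2))"
        unfolding f s_def prod.case deg Let_def scal_diff scal_scal by simp
      then show ?thesis using 3 mA by blast
    qed
  qed
qed

context curve_ideal
begin

lemma J_closed:
  assumes "approaches F f" "\<And>j. F j \<in> J"
  shows "f \<in> J"
proof -
  obtain N where N: "\<And>f. (\<And>i. Fin N \<le> val i f) \<Longrightarrow> f \<in> J" using J_conductor by blast
  obtain j where "\<And>i. Fin N \<le> val i (f - F j)"
    using assms(1) unfolding approaches_def eventually_sequentially by blast
  then have "(f - F j) + F j \<in> J" by (intro J_add N assms(2))
  then show ?thesis by simp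
qed

lemma reductions_in_J:
  assumes "terms G H \<subseteq> J" "f \<in> J" "(reduction H G)\<^sup>*\<^sup>* f f'"
  shows "f' \<in> J"
  using assms(3)
proof (induction rule: rtranclp_induct)
  case (step g g')
  obtain c m k where "g' = g - scal c m" "reducer k (terms G H) g m"
    using step.hyps(2) unfolding reduction_def by (meson k_reductionE)
  then show ?case
    using J_diff[OF step.IH J_scal[of m c]] assms(1) unfolding reducer_def by blast
qed (rule assms)

lemma final_reduction_in_J:
  assumes "terms G H \<subseteq> J" "f \<in> J" "final_reduction H G f f'"
  shows "f' \<in> J"
proof -
  obtain F where "approaches F f'" "\<And>j. (reduction H G)\<^sup>*\<^sup>* f (F j)"
    using assms(3) by (rule final_reductionE) blast
  then show ?thesis using J_closed reductions_in_J[OF assms(1,2)] by blast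
qed

end

text \<open>Makes closedness under final reductions available in the local ring itself, for
  reductions modulo \<open>({1}, G)\<close>.\<close>

lemma (in curve) curve_ideal_loc_ring: "curve_ideal \<phi> (loc_ring \<phi>)"
proof
  have "lin_span (loc_ring \<phi>) {1} = loc_ring \<phi>"
    by (auto simp: lin_span_def)
  moreover have "\<exists>x\<in>loc_ring \<phi>. \<forall>y. x * y = 0 \<longrightarrow> y = 0"
    by (rule bexI[OF _ loc_ring_one]) simp
  ultimately show "fractional_ideal \<phi> (loc_ring \<phi>)"
    unfolding fractional_ideal_def by (metis finite.emptyI finite.insertI)
qed

section \<open>Invariant and termination of the procedure\<close>

locale procedure = curve_ideal \<phi> J
  for \<phi> :: "'r::finite \<Rightarrow> ('k::field, 'n::finite) mps \<Rightarrow> 'k fls" and J :: "('k, 'r) total set" +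
  fixes G H0 :: "('k, 'r) total set" and B :: "'r \<Rightarrow> ('k, 'r) total set"
  assumes basis_G: "standard_basis_ring \<phi> G"
    and basis_B: "branch_standard_basis G J i (B i)"
    and finite_H0: "finite H0"
    and H0_J: "H0 \<subseteq> J - {0}"
    and H0_span: "lin_span (loc_ring \<phi>) H0 = J"
    and B_H0: "(\<Union>i. B i) \<subseteq> H0"
begin

definition admissible :: "('k, 'r) total set \<Rightarrow> bool" where
  "admissible H \<longleftrightarrow> finite H \<and> H \<subseteq> J - {0} \<and> H0 \<subseteq> H"

lemma finite_terms: "finite H \<Longrightarrow> locally_finite (terms G H)"
  using basis_G max_ideal_val by (intro locally_finite_terms) (auto simp: standard_basis_ring_def)

lemma gprod_loc_ring: "gprod G \<alpha> \<in> loc_ring \<phi>"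
proof -
  have "G \<subseteq> loc_ring \<phi>"
    using basis_G max_ideal_subset unfolding standard_basis_ring_def by blast
  moreover have "g ^ n \<in> loc_ring \<phi>" if "g \<in> loc_ring \<phi>" for g n
    by (induction n) (simp_all only: power_0 power_Suc loc_ring_one loc_ring_mult that)
  ultimately have "g ^ \<alpha> g \<in> loc_ring \<phi>" if "g \<in> G" for g
    using that by blast
  then show ?thesis
    unfolding gprod_def
  proof (induction G rule: infinite_finite_induct)
    case (insert g G)
    then show ?case by (simp only: prod.insert loc_ring_mult insertI1 insertI2 not_False_eq_True)
  qed (simp_all only: prod.infinite prod.empty loc_ring_one not_False_eq_True)
qed

lemma terms_J: "H \<subseteq> J \<Longrightarrow> terms G H \<subseteq> J"
  using J_mult[OF gprod_loc_ring] unfolding terms_def by blast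

text \<open>A multiple of an element of \<open>B i\<close> is supported on the branch
  \<open>i\<close>, and the images of the \<open>B i\<close> realize every value from \<kappa>
  on.\<close>

lemma branch_term_exists:
  assumes "admissible H" "kappa J i \<le> n"
  obtains m where "m \<in> terms G H" "val i m = Fin n" "\<And>j. j \<noteq> i \<Longrightarrow> val j m = Pinf"
proof -
  obtain f where f: "f \<in> branch_part J i" "val i f = Fin n"
    using kappa_values[OF assms(2)] by blast
  then have "f \<noteq> 0" by auto
  then obtain h \<alpha> where h: "h \<in> B i" "val i f = val i (gprod G \<alpha> * h)"
    using basis_B[of i] f(1) unfolding branch_standard_basis_def by blast
  have "h \<in> branch_part J i" using basis_B[of i] h(1) unfolding branch_standard_basis_def by blast
  moreover have "h \<in> H" using h(1) B_H0 assms(1) unfolding admissible_def by blast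
  ultimately show ?thesis
    using h(2) f(2)
    by (intro that[of "gprod G \<alpha> * h"]) (auto simp: terms_def branch_part_def val_eq_Pinf_iff)
qed

text \<open>Otherwise a term supported on \<open>i\<close> with the same value there is a reducer,
  whatever the values of \<open>f\<close> on the other branches.\<close>

lemma irreducible_val:
  assumes "admissible H" "\<not> (\<exists>f'. reduction H G f f')" "val i f \<noteq> Pinf"
  shows "val i f < Fin (kappa J i)"
proof (rule ccontr)
  assume *: "\<not> val i f < Fin (kappa J i)"
  obtain n where n: "val i f = Fin n" using assms(3) by (cases "val i f") auto
  then have "kappa J i \<le> n" using * by simp
  from branch_term_exists[OF assms(1) this] obtain m
    where m: "m \<in> terms G H" "val i m = Fin n" "\<And>j. j \<noteq> i \<Longrightarrow> val j m = Pinf"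
    by blast
  have "val j f \<le> val j m" for j using m n by (cases "j = i") auto
  then have "reducer i (terms G H) f m" using m n by (simp add: reducer_def)
  then show False using assms(2) reduction_exists_iff[of H G f] by blast
qed

lemma iteration_exists:
  assumes "admissible H"
  shows "\<exists>H'. iteration G J H H'"
proof -
  obtain S where S: "scalar_representatives (relevant_s_processes H G (kappa J)) S"
    using scalar_representatives_exists by blast
  \<comment> \<open>An S-process is kept only if it has a value below the bound, so it is nonzero,
    as \<open>final_reduction\<close> demands.\<close>
  have "f \<noteq> 0" if "f \<in> S" for f
    using that S unfolding scalar_representatives_def relevant_s_processes_def by force
  then have "\<forall>f\<in>S. \<exists>f'. final_reduction H G f f'"
    using final_reduction_exists finite_terms assms unfolding admissible_def by blast
  then obtain R where "\<forall>f\<in>S. final_reduction H G f (R f)" by metis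
  then show ?thesis unfolding iteration_def using S by blast
qed

lemma s_process_J:
  assumes "admissible H" "s_process k H G f"
  shows "f \<in> J"
proof -
  obtain c1 c2 h1 h2 \<alpha>1 \<alpha>2 where "h1 \<in> H" "h2 \<in> H"
    and f: "f = scal c1 (gprod G \<alpha>1 * h1) + scal c2 (gprod G \<alpha>2 * h2)"
    using assms(2) unfolding s_process_def by blast
  then have "h1 \<in> J" "h2 \<in> J" using assms(1) unfolding admissible_def by blast+
  then show ?thesis unfolding f by (intro J_add J_scal J_mult gprod_loc_ring)
qed

lemma iteration_step:
  assumes H: "admissible H" and it: "iteration G J H H'"
  shows "admissible H'" "H \<subseteq> H'"
    "f \<in> H' - H \<Longrightarrow> f \<in> J - {0} \<and> \<not> (\<exists>f'. reduction H G f f')"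
proof -
  obtain \<rho> S R where S: "scalar_representatives (relevant_s_processes H G \<rho>) S"
    and R: "\<And>f. f \<in> S \<Longrightarrow> final_reduction H G f (R f)" and H': "H' = H \<union> (R ` S - {0})"
    using it unfolding iteration_def by blast
  obtain T where "finite T"
    and "\<And>f. f \<in> relevant_s_processes H G \<rho> \<Longrightarrow> \<exists>t\<in>T. \<exists>c. c \<noteq> 0 \<and> f = scal c t"
    using relevant_s_processes_finite[OF finite_terms] H unfolding admissible_def by blast
  then have "finite S" by (rule scalar_representatives_finite[OF S])
  have "f \<in> J" if "f \<in> S" for f
    using that S s_process_J[OF H]
    unfolding scalar_representatives_def relevant_s_processes_def by blast
  moreover have "terms G H \<subseteq> J" using H terms_J unfolding admissible_def by blast
  ultimately have RJ: "R f \<in> J" if "f \<in> S" for f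
    using that R final_reduction_in_J by blast
  show "admissible H'"
    using H RJ \<open>finite S\<close> unfolding admissible_def H' by auto
  show "H \<subseteq> H'" unfolding H' by blast
  show "f \<in> J - {0} \<and> \<not> (\<exists>f'. reduction H G f f')" if "f \<in> H' - H"
    using that RJ R unfolding H' final_reduction_def by blast
qed

lemma run_admissible:
  assumes "(continuing_iteration G J)\<^sup>*\<^sup>* H0 H"
  shows "admissible H"
  using assms
proof (induction rule: rtranclp_induct)
  case base
  show ?case using finite_H0 H0_J by (simp add: admissible_def)
next
  case (step H H')
  then show ?case using iteration_step(1) unfolding continuing_iteration_def by blast
qed

lemma reducer_self: "f \<in> H \<Longrightarrow> val i f \<noteq> Pinf \<Longrightarrow> reducer i (terms G H) f f"
  by (simp add: reducer_def terms_self)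

lemma no_infinite_run:
  assumes H0: "Hs 0 = H0" and steps: "\<And>j. continuing_iteration G J (Hs j) (Hs (Suc j))"
  shows False
proof -
  have "(continuing_iteration G J)\<^sup>*\<^sup>* H0 (Hs j)" for j
    by (induction j) (use H0 steps in \<open>auto intro: rtranclp.rtrancl_into_rtrancl\<close>)
  then have adm: "admissible (Hs j)" for j by (rule run_admissible)
  have it: "iteration G J (Hs j) (Hs (Suc j))" "Hs (Suc j) \<noteq> Hs j" for j
    using steps[of j] unfolding continuing_iteration_def by blast+
  have sub: "Hs j \<subseteq> Hs j'" if "j \<le> j'" for j j'
    by (rule lift_Suc_mono_le[OF _ that]) (rule iteration_step(2)[OF adm it(1)])
  have "\<exists>f. f \<in> Hs (Suc j) - Hs j" for j
    using it(2)[of j] sub[of j "Suc j"] by auto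
  then obtain f where f: "\<And>j. f j \<in> Hs (Suc j) - Hs j" by metis
  then have fJ: "f j \<in> J - {0}" and irr: "\<not> (\<exists>f'. reduction (Hs j) G (f j) f')" for j
    using iteration_step(3)[OF adm it(1)] by blast+
  obtain L where L: "\<And>f i. f \<in> J \<Longrightarrow> Fin L \<le> val i f" using J_lower_bound by blast
  \<comment> \<open>Finite values are bounded below on \<open>J\<close> and above by irreducibility,
    so the infinitely many new elements share finitely many value vectors.\<close>
  define V where "V = insert Pinf (Fin ` {L..Max (range (kappa J))})"
  have in_V: "val i (f j) \<in> V" for i j
  proof (cases "val i (f j)")
    case (Fin n)
    have "val i (f j) < Fin (kappa J i)"
      by (rule irreducible_val[OF adm irr]) (simp add: Fin)
    moreover have "kappa J i \<le> Max (range (kappa J))" by simp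
    moreover have "Fin L \<le> val i (f j)" using L fJ by blast
    ultimately have "n \<in> {L..Max (range (kappa J))}" 
      by (simp only: Fin less_extended_simps less_eq_extended.simps atLeastAtMost_iff simp_thms)
    then show ?thesis unfolding V_def Fin by blast
  qed (auto simp: V_def)
  have "inj (\<lambda>j i. val i (f j))"
  proof (rule linorder_injI)
    fix j j' :: nat assume "j < j'"
    show "(\<lambda>i. val i (f j)) \<noteq> (\<lambda>i. val i (f j'))"
    proof
      assume eq: "(\<lambda>i. val i (f j)) = (\<lambda>i. val i (f j'))"
      have mem: "f j \<in> Hs j'" using f[of j] sub[of "Suc j" j'] \<open>j < j'\<close> by auto
      obtain i n where "val i (f j') = Fin n" using nonzero_obtain_val[of "f j'"] fJ by blast
      then have "reducer i (terms G (Hs j')) (f j') (f j)"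
        using fun_cong[OF eq] terms_self[OF mem, of G] by (simp add: reducer_def)
      then show False using irr[of j'] reduction_exists_iff[of "Hs j'" G "f j'"] by blast
    qed
  qed
  moreover have "finite {v :: 'r \<Rightarrow> int extended. \<forall>i. v i \<in> V}"
    using finite_set_of_finite_funs[of "UNIV :: 'r set" V Pinf] by (simp add: V_def)
  then have "finite (range (\<lambda>j i. val i (f j)))"
    by (rule finite_subset[rotated]) (auto simp: in_V)
  ultimately show False using finite_imageD by fastforce
qed

section \<open>Representations by terms and correctness of the output\<close>

text \<open>Reduction does not lower values, while a finite value of the irreducible result would be
  below \<kappa>; so the result is 0.\<close>

lemma approx_above_kappa:
  assumes H: "admissible H" and f: "f \<in> J" "\<And>i. Fin (kappa J i) \<le> val i f"
  shows "approx (terms G H) (\<lambda>i. val i f) N f"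
proof (cases "f = 0")
  case True
  then show ?thesis by (simp add: approx_error)
next
  case False
  then obtain f' where f': "final_reduction H G f f'"
    using final_reduction_exists finite_terms H unfolding admissible_def by blast
  have "val i f \<le> val i f'" for i
    by (rule final_reduction_val_mono[OF f'])
  then have "val i f' = Pinf" for i
    using f(2)[of i] irreducible_val[OF H, of f' i] f' unfolding final_reduction_def
    by (meson leD order.strict_trans1 order.trans)
  then have "f' = 0" by (auto simp: val_eq_Pinf_iff)
  then show ?thesis using f' approx_final_reduction_zero by blast
qed

text \<open>For a relevant process, stopping puts a nonzero final reduction of its representative
  into \<open>H\<close>, where it would reduce itself; so this reduction is 0. Any other process
  lies above \<kappa>.\<close>

lemma approx_s_process:
  assumes H: "admissible H" and stop: "iteration G J H H" and s: "s_process k H G f"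
  shows "approx (terms G H) (\<lambda>i. val i f) N f"
proof -
  obtain \<rho> S R where \<rho>: "\<And>i. kappa J i \<le> \<rho> i"
    and S: "scalar_representatives (relevant_s_processes H G \<rho>) S"
    and R: "\<And>f. f \<in> S \<Longrightarrow> final_reduction H G f (R f)" and RS: "H = H \<union> (R ` S - {0})"
    using stop unfolding iteration_def by blast
  show ?thesis
  proof (cases "\<exists>i. val i f < Fin (\<rho> i)")
    case True
    then have "f \<in> relevant_s_processes H G \<rho>"
      using s unfolding relevant_s_processes_def by blast
    then obtain g c where g: "g \<in> S" "c \<noteq> 0" "f = scal c g"
      using S unfolding scalar_representatives_def by blast
    have "R g = 0"
    proof (rule ccontr)
      assume nz: "R g \<noteq> 0"
      then have "R g \<in> H" using RS g(1) by blast
      moreover obtain i n where "val i (R g) = Fin n" using nonzero_obtain_val[OF nz] by blast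
      ultimately have "reducer i (terms G H) (R g) (R g)" by (simp add: reducer_self)
      then show False
        using R[OF g(1)] reduction_exists_iff[of H G "R g"] unfolding final_reduction_def by blast
    qed
    then have "approx (terms G H) (\<lambda>i. val i g) N g"
      using R[OF g(1)] by (intro approx_final_reduction_zero) simp
    then show ?thesis using approx_scal[of _ _ _ g c] g by simp
  next
    case False
    have "Fin (kappa J i) \<le> val i f" for i
    proof -
      have "Fin (kappa J i) \<le> Fin (\<rho> i)" using \<rho>[of i] by simp
      then show ?thesis using False by (meson not_le order.trans)
    qed
    then show ?thesis by (intro approx_above_kappa H s_process_J[OF H s])
  qed
qed

text \<open>The terms of minimal value on the branch \<open>k\<close> cancel there, so their sum is a combination of
  \<open>S\<^sub>k\<close>-processes with one of them.\<close>

lemma approx_improve: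
  assumes H: "admissible H" and stop: "iteration G J H H"
    and ap: "approx (terms G H) (\<lambda>i. Fin (l i)) N f" and k: "Fin (l k) < val k f" "l k < N"
  shows "approx (terms G H) (\<lambda>i. Fin ((l(k := l k + 1)) i)) N f"
proof -
  let ?M = "terms G H" and ?v = "\<lambda>i. Fin ((l(k := l k + 1)) i)"
  obtain A c e where A: "finite A" "A \<subseteq> ?M" "\<And>m i. m \<in> A \<Longrightarrow> Fin (l i) \<le> val i m"
    and f: "f = (\<Sum>m\<in>A. scal (c m) m) + e" and e: "\<And>i. Fin N \<le> val i e"
    using ap by (rule approxE) blast
  have gt: "Fin (n + 1) \<le> val i g" if "Fin n < val i g" for n i and g :: "('k, 'r) total"
    using that by (cases "val i g") auto
  define A1 where "A1 = {m \<in> A. val k m = Fin (l k)}"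
  have "finite A1" "A1 \<subseteq> A" using A(1) by (auto simp: A1_def)
  have "approx ?M ?v N m" if "m \<in> A - A1" for m
  proof (rule approx_term)
    show "m \<in> ?M" using that A(2) by blast
    have "Fin (l k) < val k m"
      using that A(3)[of m k] by (auto simp: A1_def order.order_iff_strict)
    then show "?v i \<le> val i m" for i using that A(3)[of m i] gt by auto
  qed
  then have rest: "approx ?M ?v N (\<Sum>m\<in>A - A1. scal (c m) m)"
    by (intro approx_sum approx_scal)
  have min_part: "approx ?M ?v N (\<Sum>m\<in>A1. scal (c m) m)"
  proof (cases "A1 = {}")
    case False
    then obtain m1 where m1: "m1 \<in> A1" by blast
    define q where "q m = m k $$ l k / m1 k $$ l k" for m :: "('k, 'r) total"
    have lc: "m1 k $$ l k \<noteq> 0"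
      using m1 unfolding A1_def val_eq_fls_val fls_val_eq_Fin_iff by blast
    have "approx ?M ?v N (m - scal (q m) m1)" if m: "m \<in> A1" for m
    proof -
      have vals: "val k m = Fin (l k)" "val k m1 = Fin (l k)" using m m1 by (auto simp: A1_def)
      then have less: "Fin (l k) < val k (m - scal (q m) m1)"
        unfolding q_def val_eq_fls_val by (simp add: fls_val_cancel)
      obtain \<alpha> h \<alpha>1 h1 where h: "h \<in> H" "m = gprod G \<alpha> * h" "h1 \<in> H" "m1 = gprod G \<alpha>1 * h1"
        using m m1 A(2) \<open>A1 \<subseteq> A\<close> unfolding terms_def by blast
      have "m - scal (q m) m1 = scal 1 m + scal (- q m) m1"
        by (simp add: fun_eq_iff)
      then have "s_process k H G (m - scal (q m) m1)"
        unfolding s_process_def using h vals less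
        by (intro exI[of _ 1] exI[of _ "- q m"] bexI[of _ h] bexI[of _ h1] exI[of _ \<alpha>] exI[of _ \<alpha>1]) simp_all
      then have "approx ?M (\<lambda>i. val i (m - scal (q m) m1)) N (m - scal (q m) m1)"
        by (rule approx_s_process[OF H stop])
      moreover have "?v i \<le> val i (m - scal (q m) m1)" for i
        using gt[OF less] m m1 A(3) \<open>A1 \<subseteq> A\<close>
        by (cases "i = k") (auto intro!: val_diff val_scal_ge)
      ultimately show ?thesis by (rule approx_mono[OF _ order.refl])
    qed
    then have "approx ?M ?v N (\<Sum>m\<in>A1. scal (c m) (m - scal (q m) m1))"
      by (intro approx_sum approx_scal)
    moreover have "(\<Sum>m\<in>A1. scal (c m) (m - scal (q m) m1)) = (\<Sum>m\<in>A1. scal (c m) m)"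
    proof -
      \<comment> \<open>The other terms and the error start beyond \<open>l k\<close>, and so does
        \<open>f\<close>. Hence the \<open>c m * q m\<close> sum to 0, and replacing each
        \<open>m\<close> by its S-process with \<open>m1\<close> does not change the sum.\<close>
      have "(\<Sum>m\<in>A1. c m * m k $$ l k) = 0"
      proof -
        have "f k $$ l k = 0"
          using gt[OF k(1)] unfolding val_eq_fls_val fls_val_ge_iff by simp
        moreover have "e k $$ l k = 0"
          using e[of k] k(2) unfolding val_eq_fls_val fls_val_ge_iff by simp
        ultimately have "(\<Sum>m\<in>A. c m * m k $$ l k) = 0"
          by (simp add: f sum_fun_apply fls_nth_sum)
        moreover have "m k $$ l k = 0" if "m \<in> A - A1" for m
        proof -
          have "Fin (l k) < val k m"
            using that A(3)[of m k] by (auto simp: A1_def order.order_iff_strict)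
          from gt[OF this] show ?thesis unfolding val_eq_fls_val fls_val_ge_iff by simp
        qed
        ultimately show ?thesis
          using sum.mono_neutral_left[OF A(1) \<open>A1 \<subseteq> A\<close>, of "\<lambda>m. c m * m k $$ l k"] by simp
      qed
      then have cq: "(\<Sum>m\<in>A1. c m * q m) = 0"
        unfolding q_def times_divide_eq_right sum_divide_distrib[symmetric] by simp
      have "(\<Sum>m\<in>A1. fls_const (c m * q m)) $$ n = 0" for n
        using cq by (cases "n = 0") (simp_all add: fls_nth_sum)
      then have "(\<Sum>m\<in>A1. fls_const (c m * q m)) = 0" by (intro fls_eqI) simp
      then have "(\<Sum>m\<in>A1. scal (c m * q m) m1) = 0"
        by (simp add: fun_eq_iff sum_fun_apply flip: sum_distrib_right)
      then show ?thesis by (simp add: scal_diff sum_subtractf)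
    qed
    ultimately show ?thesis by simp
  qed (simp add: approx_error)
  have "f = (\<Sum>m\<in>A - A1. scal (c m) m) + (\<Sum>m\<in>A1. scal (c m) m) + e"
    unfolding f by (subst sum.subset_diff[OF \<open>A1 \<subseteq> A\<close> A(1)]) simp
  then show ?thesis
    using approx_add[OF approx_add[OF rest min_part] approx_error[OF e]] by simp
qed

text \<open>Each use of \<open>approx_improve\<close> raises one bound by one, so the total deficit
  decreases; this requires finite targets \<open>w\<close>.\<close>

lemma approx_lift:
  assumes H: "admissible H" and stop: "iteration G J H H"
    and w: "\<And>i. w i \<le> N" "\<And>i. Fin (w i) \<le> val i f"
  shows "approx (terms G H) (\<lambda>i. Fin (l i)) N f \<Longrightarrow> approx (terms G H) (\<lambda>i. Fin (w i)) N f"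
proof (induction "\<Sum>i\<in>UNIV. nat (w i - l i)" arbitrary: l rule: less_induct)
  case less
  show ?case
  proof (cases "\<exists>k. l k < w k")
    case False
    then show ?thesis by (intro approx_mono[OF less.prems]) (auto simp: not_less)
  next
    case True
    then obtain k where k: "l k < w k" by blast
    let ?l = "l(k := l k + 1)"
    have "Fin (l k) < val k f"
      using k by (intro less_le_trans[OF _ w(2)]) simp
    then have "approx (terms G H) (\<lambda>i. Fin (?l i)) N f"
      using k w(1)[of k] by (intro approx_improve[OF H stop less.prems]) auto
    moreover have "(\<Sum>i\<in>UNIV. nat (w i - ?l i)) < (\<Sum>i\<in>UNIV. nat (w i - l i))"
      using k by (intro sum_strict_mono_ex1) (auto intro!: exI[of _ k])
    ultimately show ?thesis by (intro less.hyps[of ?l])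
  qed
qed

text \<open>A final reduction stays in the local ring, where only 0 is irreducible because
  \<open>G\<close> is a Standard Basis.\<close>

lemma approx_loc_ring:
  assumes "a \<in> loc_ring \<phi>"
  shows "approx (terms G {1}) (\<lambda>_. Fin 0) N a"
proof (cases "a = 0")
  case False
  interpret O: curve_ideal \<phi> "loc_ring \<phi>" by (rule curve_ideal_loc_ring)
  obtain a' where a': "final_reduction {1} G a a'"
    using final_reduction_exists[OF finite_terms False] by blast
  have "terms G {1} \<subseteq> loc_ring \<phi>"
    using gprod_loc_ring by (auto simp: terms_def)
  then have "a' \<in> loc_ring \<phi>" using O.final_reduction_in_J assms a' by blast
  then have "a' = 0"
    using basis_G a' unfolding standard_basis_ring_def final_reduction_def by blast
  then have "approx (terms G {1}) (\<lambda>i. val i a) N a"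
    using a' approx_final_reduction_zero by blast
  then show ?thesis by (rule approx_mono) (use loc_ring_val assms in auto)
qed (simp add: approx_error)

text \<open>Supplies the starting representation for \<open>approx_lift\<close>: the coefficients of
  the generators in \<open>H0\<close> are themselves expanded in \<open>G\<close>-products.\<close>

lemma approx_J:
  assumes H: "admissible H"
  obtains L where "\<And>f N. f \<in> J \<Longrightarrow> approx (terms G H) (\<lambda>_. Fin L) N f"
proof -
  obtain L where L: "\<And>f i. f \<in> J \<Longrightarrow> Fin L \<le> val i f" using J_lower_bound by blast
  show ?thesis
  proof
    fix f N assume "f \<in> J"
    then obtain a where f: "f = (\<Sum>h\<in>H0. a h * h)" and a: "\<And>h. h \<in> H0 \<Longrightarrow> a h \<in> loc_ring \<phi>"
      using H0_span unfolding lin_span_def by blast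
    have "approx (terms G H) (\<lambda>_. Fin L) N (a h * h)" if hH0: "h \<in> H0" for h
    proof -
      have h: "Fin L \<le> val i h" "h \<in> H" for i
        using hH0 H0_J L H unfolding admissible_def by blast+
      \<comment> \<open>The precision \<open>N - L\<close> makes up for the value of
        \<open>h\<close>, which may be as low as \<open>L\<close>.\<close>
      obtain A c e where A: "finite A" "A \<subseteq> terms G {1}" "\<And>m i. m \<in> A \<Longrightarrow> Fin 0 \<le> val i m"
        and ah: "a h = (\<Sum>m\<in>A. scal (c m) m) + e" and e: "\<And>i. Fin (N - L) \<le> val i e"
        using approx_loc_ring[OF a[OF hH0], of "N - L"] by (rule approxE) blast
      have "approx (terms G H) (\<lambda>_. Fin L) N (m * h)" if "m \<in> A" for m
      proof (rule approx_term)
        show "m * h \<in> terms G H" using that A(2) h(2) unfolding terms_def by fastforce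
        show "Fin L \<le> val i (m * h)" for i
          using val_mult_ge[OF A(3)[OF that] h(1), of i] by simp
      qed
      moreover have "Fin N \<le> val i (e * h)" for i
        using val_mult_ge[OF e h(1), of i] by simp
      ultimately have "approx (terms G H) (\<lambda>_. Fin L) N ((\<Sum>m\<in>A. scal (c m) (m * h)) + e * h)"
        by (intro approx_add approx_sum approx_scal) (simp_all add: approx_error)
      moreover have "a h * h = (\<Sum>m\<in>A. scal (c m) (m * h)) + e * h"
        by (simp add: ah fun_eq_iff sum_fun_apply distrib_right sum_distrib_right mult.assoc)
      ultimately show ?thesis by simp
    qed
    then show "approx (terms G H) (\<lambda>_. Fin L) N f" unfolding f by (rule approx_sum)
  qed
qed

text \<open>For an irreducible \<open>f\<close> one finds a representation whose terms have at least the values of \<open>f\<close>,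
  where an infinite value is replaced by a bound \<open>D\<close> so large that a term of value at least
  \<open>D\<close> on one branch is either infinite there or has values above \<open>\<kappa>\<close> on all branches. A term
  whose value agrees with that of \<open>f\<close> on some branch is then a reducer of \<open>f\<close>.\<close>

lemma output_standard_basis:
  assumes H: "admissible H" and stop: "iteration G J H H"
  shows "standard_basis G J H"
  unfolding standard_basis_def
proof (intro conjI ballI impI)
  fix f assume f: "f \<in> J" "f \<noteq> 0"
  show "\<exists>f'. reduction H G f f'"
  proof (rule ccontr)
    assume irr: "\<not> (\<exists>f'. reduction H G f f')"
    define K where "K = Max (range (kappa J))"
    have K: "kappa J i \<le> K" for i by (simp add: K_def)
    have "locally_finite (terms G H)" using H finite_terms by (simp add: admissible_def)
    then obtain D where D: "\<And>m i j. m \<in> terms G H \<Longrightarrow> val i m < Fin K \<Longrightarrow> val j m < Fin D \<or> val j m = Pinf"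
      using locally_finite_bound by blast
    \<comment> \<open>All targets \<open>w i\<close> are then below \<open>N\<close>, being
      \<open>D\<close> or less than \<open>K\<close>, so the error cannot touch the leading
      coefficients of \<open>f\<close>.\<close>
    define N where "N = max D K + 1"
    define w where "w i = (if val i f = Pinf then D else fls_subdegree (f i))" for i
    have val_f: "val i f = Fin (w i)" "w i < K" if "val i f \<noteq> Pinf" for i
    proof -
      show eq: "val i f = Fin (w i)" using that by (auto simp: w_def val_def split: if_splits)
      show "w i < K" using irreducible_val[OF H irr that] K[of i] unfolding eq by simp
    qed
    obtain L where "\<And>f N. f \<in> J \<Longrightarrow> approx (terms G H) (\<lambda>_. Fin L) N f"
      using approx_J[OF H] by blast
    then have "approx (terms G H) (\<lambda>i. Fin ((\<lambda>_. L) i)) N f" using f(1) by blast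
    then have "approx (terms G H) (\<lambda>i. Fin (w i)) N f"
    proof (rule approx_lift[OF H stop, rotated 2])
      show "w i \<le> N" for i
        using val_f(2)[of i] by (cases "val i f = Pinf") (auto simp: N_def w_def)
      show "Fin (w i) \<le> val i f" for i
        using val_f(1)[of i] by (cases "val i f = Pinf") auto
    qed
    then obtain A c e where A: "finite A" "A \<subseteq> terms G H" "\<And>m i. m \<in> A \<Longrightarrow> Fin (w i) \<le> val i m"
      and sum: "f = (\<Sum>m\<in>A. scal (c m) m) + e" and e: "\<And>i. Fin N \<le> val i e"
      by (rule approxE) blast
    obtain k n where "val k f = Fin n" using nonzero_obtain_val[OF f(2)] by blast
    then have k: "val k f = Fin (w k)" "w k < K" using val_f[of k] by auto
    then have "f k $$ w k \<noteq> 0" unfolding val_eq_fls_val fls_val_eq_Fin_iff by blast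
    moreover have "e k $$ w k = 0"
      using e[of k] k(2) unfolding val_eq_fls_val fls_val_ge_iff by (simp add: N_def)
    ultimately have "(\<Sum>m\<in>A. c m * m k $$ w k) \<noteq> 0"
      by (simp add: sum sum_fun_apply fls_nth_sum)
    \<comment> \<open>Some term must contribute to the leading coefficient of \<open>f\<close> on
      \<open>k\<close>; as all terms have value at least \<open>w k\<close> there, its value is
      exactly \<open>w k\<close>.\<close>
    then obtain m where m: "m \<in> A" "m k $$ w k \<noteq> 0"
      by (metis (no_types, lifting) mult_zero_right sum.neutral)
    have "val k m = Fin (w k)"
      using m A(3)[of m k] unfolding val_eq_fls_val fls_val_eq_Fin_iff fls_val_ge_iff by blast
    moreover have "val i f \<le> val i m" for i
    proof (cases "val i f = Pinf")
      case True
      then have "Fin D \<le> val i m" using A(3)[OF m(1), of i] by (simp add: w_def)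
      moreover have "val i m < Fin D \<or> val i m = Pinf"
        using D[of m k i] m A(2) k(2) \<open>val k m = Fin (w k)\<close> by auto
      ultimately show ?thesis by auto
    next
      case False
      then show ?thesis using A(3)[OF m(1), of i] val_f(1)[of i] by simp
    qed
    ultimately have "reducer k (terms G H) f m"
      using m A(2) k(1) by (auto simp: reducer_def)
    then show False using irr reduction_exists_iff[of H G f] by blast
  qed
qed (use H in \<open>auto simp: admissible_def\<close>)

end

theorem theorem16:
  fixes Q :: "('k::alg_closed_field, 'n::finite) mps set"
    and P :: "'r::finite \<Rightarrow> ('k, 'n) mps set"
    and \<phi> :: "'r \<Rightarrow> ('k, 'n) mps \<Rightarrow> 'k fls"
    and J G H0 :: "('k, 'r) total set"
    and B :: "'r \<Rightarrow> ('k, 'r) total set"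
  assumes "algebroid_curve Q P \<phi>"
    and "fractional_ideal \<phi> J"
    and "standard_basis_ring \<phi> G"
    and "\<And>i. branch_standard_basis G J i (B i)"
    and "finite H0" and "H0 \<subseteq> J - {0}" and "lin_span (loc_ring \<phi>) H0 = J"
    and "(\<Union>i. B i) \<subseteq> H0"
  shows \<comment> \<open>every iteration can be carried out\<close>
    "(\<forall>H. (continuing_iteration G J)\<^sup>*\<^sup>* H0 H \<longrightarrow> (\<exists>H'. iteration G J H H')) \<and>
     \<comment> \<open>no run goes on forever\<close>
     \<not> (\<exists>Hs. Hs 0 = H0 \<and> (\<forall>j. continuing_iteration G J (Hs j) (Hs (Suc j)))) \<and>
     \<comment> \<open>the output of every run\<close>
     (\<forall>H. (continuing_iteration G J)\<^sup>*\<^sup>* H0 H \<and> iteration G J H H \<longrightarrow> standard_basis G J H)"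
proof -
  interpret curve \<phi> by (rule curve_if_algebroid_curve[OF assms(1)])
  interpret procedure \<phi> J G H0 B
    by unfold_locales (rule assms)+
  show ?thesis
    using run_admissible iteration_exists no_infinite_run output_standard_basis by blast
qed

end
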